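(* Let $T$ be a consistent RE theory and $n\geq1$. Suppose $T$ is $n$-Rosser via an interpretation $I:{\sf Num}\unlhd T$, and for every $h\in\mathbb N$ the $n$-ary functional $F_h(\vec x)=(J_{n+1}(h,\vec x),\dots,J_{n+1}(h,\vec x))$ on $\mathbb N^n$ is admissible in $T$ with respect to $I$. Then $T$ is exact $n$-Rosser.
   Context: $J_2:\mathbb N^2\to\mathbb N$ is a fixed recursive pairing function (bijection) and $J_{k+1}(x_1,\dots,x_{k+1})=J_2(J_k(x_1,\dots,x_k),x_{k+1})$. A fixed Gödel numbering of formulas is used. ${\sf Num}$ is the theory in the language $\{\mathbf 0,\mathbf S\}$ with axioms $\overline m\neq\overline n$ for $m\neq n$, where $\overline 0=\mathbf 0$, $\overline{k+1}=\mathbf S\overline k$. An interpretation $I:{\sf Num}\unlhd T$ is a translation of the language of ${\sf Num}$ into that of $T$ (domain formula and translations of $=,\mathbf 0,\mathbf S$) such that $T$ proves totality of translated function symbols on the domain, the translations of all theorems of ${\sf Num}$ and of the equality axioms; $\overline a^I$ is the $I$-translation of $\overline a$. A formula $\phi(x_1,\dots,x_n)$ with exactly $n$ free variables strongly separates $n$-ary relations $M_1$ from $M_2$ in $T$ w.r.t. $I$ if $\vec a\in M_1\Rightarrow T\vdash\phi(\overline{a_1}^I,\dots,\overline{a_n}^I)$ and $\vec a\in M_2\Rightarrow T\vdash\neg\phi(\overline{a_1}^I,\dots,\overline{a_n}^I)$; for disjoint $M_1,M_2$ it exactly separates them if both are equivalences. $T$ is $n$-Rosser via $I$ if for every pair of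 $n$-ary RE relations $M_1,M_2$ some formula strongly separates $M_1\setminus M_2$ from $M_2\setminus M_1$ w.r.t. $I$; $T$ is exact $n$-Rosser if for some interpretation of ${\sf Num}$ in $T$ every disjoint pair of $n$-ary RE relations is exactly separated by some formula w.r.t. it. An $n$-ary functional $F=(f_1,\dots,f_n):\mathbb N^m\to\mathbb N^n$ is admissible in $T$ w.r.t. $I$ if for every formula $\phi(x_1,\dots,x_n)$ there is a formula $\psi(x_1,\dots,x_m)$ such that for all $\vec a\in\mathbb N^m$, $T\vdash\psi(\overline{a_1}^I,\dots,\overline{a_m}^I)\leftrightarrow\phi(\overline{f_1(\vec a)}^I,\dots,\overline{f_n(\vec a)}^I)$. *)

theory Defs
  imports "HOL-Library.Nat_Bijection"
begin

section \<open>Recursively enumerable relations\<close>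

text \<open>Partial recursive functions. Arities are not tracked by the type: on arguments of a given
  length, an ill-formed expression is undefined. The recursion variable of \<open>PrimRec\<close> and the
  variable minimised by \<open>Mu\<close> come first in the argument list.\<close>

datatype recf = Zero | Succ | Proj nat | Comp recf "recf list" | PrimRec recf recf | Mu recf

inductive rec_eval :: "recf \<Rightarrow> nat list \<Rightarrow> nat \<Rightarrow> bool" where
  Zero: "rec_eval Zero xs 0"
| Succ: "rec_eval Succ [x] (Suc x)"
| Proj: "i < length xs \<Longrightarrow> rec_eval (Proj i) xs (xs ! i)"
| Comp: "list_all2 (\<lambda>g y. rec_eval g xs y) gs ys \<Longrightarrow> rec_eval f ys z \<Longrightarrow> rec_eval (Comp f gs) xs z"
| PrimRec_0: "rec_eval f xs y \<Longrightarrow> rec_eval (PrimRec f g) (0 # xs) y"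
| PrimRec_Suc: "rec_eval (PrimRec f g) (k # xs) r \<Longrightarrow> rec_eval g (k # r # xs) y \<Longrightarrow>
    rec_eval (PrimRec f g) (Suc k # xs) y"
| Mu: "rec_eval f (k # xs) 0 \<Longrightarrow> (\<And>j. j < k \<Longrightarrow> \<exists>y. rec_eval f (j # xs) (Suc y)) \<Longrightarrow>
    rec_eval (Mu f) xs k"

definition nary :: "nat \<Rightarrow> nat list set \<Rightarrow> bool" where
  "nary n M \<longleftrightarrow> (\<forall>xs\<in>M. length xs = n)"

definition RE :: "nat \<Rightarrow> nat list set \<Rightarrow> bool" where
  "RE n M \<longleftrightarrow> nary n M \<and>
     (\<exists>f. \<forall>xs. length xs = n \<longrightarrow> (xs \<in> M \<longleftrightarrow> (\<exists>y. rec_eval f xs y)))"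

definition recursive_pairing :: "(nat \<Rightarrow> nat \<Rightarrow> nat) \<Rightarrow> bool" where
  "recursive_pairing J \<longleftrightarrow> bij (\<lambda>(x, y). J x y) \<and> (\<exists>f. \<forall>x y. rec_eval f [x, y] (J x y))"

text \<open>\<open>J_k(x_1, \<dots>, x_k)\<close> is \<open>tupling J [x_1, \<dots>, x_k]\<close>, associating to the left;
  \<open>J_1\<close> is the identity.\<close>

fun tupling :: "(nat \<Rightarrow> nat \<Rightarrow> nat) \<Rightarrow> nat list \<Rightarrow> nat" where
  "tupling J [] = 0"
| "tupling J (x # xs) = foldl J x xs"

section \<open>First-order logic with equality\<close>

text \<open>De Bruijn syntax. A symbol is a number together with its arity, the length of the
  argument list.\<close>

datatype tm = Var nat | Fun nat "tm list"

datatype fm = Falsum | Eq tm tm | Rel nat "tm list" | Imp fm fm | All fm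

abbreviation Neg :: "fm \<Rightarrow> fm" where "Neg p \<equiv> Imp p Falsum"
abbreviation And :: "fm \<Rightarrow> fm \<Rightarrow> fm" where "And p q \<equiv> Neg (Imp p (Neg q))"
abbreviation Iff :: "fm \<Rightarrow> fm \<Rightarrow> fm" where "Iff p q \<equiv> And (Imp p q) (Imp q p)"
abbreviation Ex :: "fm \<Rightarrow> fm" where "Ex p \<equiv> Neg (All (Neg p))"

primrec fv_tm :: "tm \<Rightarrow> nat set" where
  "fv_tm (Var i) = {i}"
| "fv_tm (Fun f ts) = \<Union> (set (map fv_tm ts))"

primrec fv :: "fm \<Rightarrow> nat set" where
  "fv Falsum = {}"
| "fv (Eq s t) = fv_tm s \<union> fv_tm t"
| "fv (Rel r ts) = \<Union> (fv_tm ` set ts)"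
| "fv (Imp p q) = fv p \<union> fv q"
| "fv (All p) = {i. Suc i \<in> fv p}"

record signature =
  funs :: "(nat \<times> nat) set"
  rels :: "(nat \<times> nat) set"

primrec wf_tm :: "signature \<Rightarrow> tm \<Rightarrow> bool" where
  "wf_tm L (Var i) \<longleftrightarrow> True"
| "wf_tm L (Fun f ts) \<longleftrightarrow> (f, length ts) \<in> funs L \<and> list_all (wf_tm L) ts"

primrec wf_fm :: "signature \<Rightarrow> fm \<Rightarrow> bool" where
  "wf_fm L Falsum \<longleftrightarrow> True"
| "wf_fm L (Eq s t) \<longleftrightarrow> wf_tm L s \<and> wf_tm L t"
| "wf_fm L (Rel r ts) \<longleftrightarrow> (r, length ts) \<in> rels L \<and> list_all (wf_tm L) ts"
| "wf_fm L (Imp p q) \<longleftrightarrow> wf_fm L p \<and> wf_fm L q"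
| "wf_fm L (All p) \<longleftrightarrow> wf_fm L p"

primrec subst_tm :: "(nat \<Rightarrow> tm) \<Rightarrow> tm \<Rightarrow> tm" where
  "subst_tm \<sigma> (Var i) = \<sigma> i"
| "subst_tm \<sigma> (Fun f ts) = Fun f (map (subst_tm \<sigma>) ts)"

abbreviation lift_tm :: "tm \<Rightarrow> tm" where
  "lift_tm \<equiv> subst_tm (\<lambda>i. Var (Suc i))"

primrec subst :: "(nat \<Rightarrow> tm) \<Rightarrow> fm \<Rightarrow> fm" where
  "subst \<sigma> Falsum = Falsum"
| "subst \<sigma> (Eq s t) = Eq (subst_tm \<sigma> s) (subst_tm \<sigma> t)"
| "subst \<sigma> (Rel r ts) = Rel r (map (subst_tm \<sigma>) ts)"
| "subst \<sigma> (Imp p q) = Imp (subst \<sigma> p) (subst \<sigma> q)"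
| "subst \<sigma> (All p) = All (subst (case_nat (Var 0) (\<lambda>i. lift_tm (\<sigma> i))) p)"

abbreviation lift :: "fm \<Rightarrow> fm" where
  "lift \<equiv> subst (\<lambda>i. Var (Suc i))"

text \<open>Instantiation of the outermost bound variable of \<open>All p\<close>.\<close>

abbreviation inst :: "tm \<Rightarrow> fm \<Rightarrow> fm" where
  "inst t \<equiv> subst (case_nat t Var)"

text \<open>A Hilbert calculus. The set of axioms is meant to consist of sentences, which makes
  unrestricted generalisation sound. Derivations may use all symbols; for formulas over a
  signature that contains the symbols of \<open>T\<close> this is conservative.\<close>

inductive provable :: "fm set \<Rightarrow> fm \<Rightarrow> bool" (infix "\<turnstile>" 50) for T where
  Ax: "p \<in> T \<Longrightarrow> T \<turnstile> p"
| K: "T \<turnstile> Imp p (Imp q p)"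
| S: "T \<turnstile> Imp (Imp p (Imp q r)) (Imp (Imp p q) (Imp p r))"
| DN: "T \<turnstile> Imp (Neg (Neg p)) p"
| MP: "T \<turnstile> Imp p q \<Longrightarrow> T \<turnstile> p \<Longrightarrow> T \<turnstile> q"
| Inst: "T \<turnstile> Imp (All p) (inst t p)"
| Dist: "T \<turnstile> Imp (All (Imp p q)) (Imp (All p) (All q))"
| Vacuous: "T \<turnstile> Imp p (All (lift p))"
| Gen: "T \<turnstile> p \<Longrightarrow> T \<turnstile> All p"
| Refl: "T \<turnstile> Eq t t"
| Leibniz: "T \<turnstile> Imp (Eq s t) (Imp (inst s p) (inst t p))"

definition is_theory :: "signature \<Rightarrow> fm set \<Rightarrow> bool" where
  "is_theory L T \<longleftrightarrow> (\<forall>p\<in>T. wf_fm L p \<and> fv p = {})"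

definition consistent :: "fm set \<Rightarrow> bool" where
  "consistent T \<longleftrightarrow> \<not> T \<turnstile> Falsum"

section \<open>Goedel numbering\<close>

primrec gn_tm :: "tm \<Rightarrow> nat" where
  "gn_tm (Var i) = prod_encode (0, i)"
| "gn_tm (Fun f ts) = prod_encode (1, prod_encode (f, list_encode (map gn_tm ts)))"

primrec gn :: "fm \<Rightarrow> nat" where
  "gn Falsum = prod_encode (0, 0)"
| "gn (Eq s t) = prod_encode (1, prod_encode (gn_tm s, gn_tm t))"
| "gn (Rel r ts) = prod_encode (2, prod_encode (r, list_encode (map gn_tm ts)))"
| "gn (Imp p q) = prod_encode (3, prod_encode (gn p, gn q))"
| "gn (All p) = prod_encode (4, gn p)"

definition RE_theory :: "fm set \<Rightarrow> bool" where
  "RE_theory T \<longleftrightarrow> RE 1 {[gn p] |p. p \<in> T}"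

section \<open>The theory Num and its interpretations\<close>

definition sig_Num :: signature where
  "sig_Num = \<lparr>funs = {(0, 0), (1, 1)}, rels = {}\<rparr>"

primrec numeral_tm :: "nat \<Rightarrow> tm" where
  "numeral_tm 0 = Fun 0 []"
| "numeral_tm (Suc k) = Fun 1 [numeral_tm k]"

definition Num :: "fm set" where
  "Num = {Neg (Eq (numeral_tm m) (numeral_tm n)) |m n. m \<noteq> n}"

text \<open>A translation of the language of \<open>Num\<close>. The argument of \<open>dom_of\<close> and of \<open>zero_of\<close> is
  variable 0. In \<open>succ_of\<close>, which translates \<open>S x = y\<close>, \<open>x\<close> is variable 0 and \<open>y\<close> is variable 1.\<close>

record translation =
  dom_of :: fm
  eq_of :: fm
  zero_of :: fm
  succ_of :: fm

text \<open>The formula \<open>p(x_0, \<dots>, x_k)\<close> evaluated at a list of variables.\<close>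

definition at_vars :: "fm \<Rightarrow> nat list \<Rightarrow> fm" where
  "at_vars p vs = subst (\<lambda>i. Var (vs ! i)) p"

lemma size_lift_tm [simp]: "size (lift_tm t) = size t"
  by (induction t) (simp_all add: size_list_conv_sum_list comp_def cong: map_cong)

text \<open>\<open>trans_val I t x\<close> translates \<open>t = x\<close> for a variable \<open>x\<close>, after unnesting: function symbols
  only occur in atomic formulas \<open>0 = x\<close> and \<open>S y = x\<close> with \<open>x, y\<close> variables. Only terms over
  the signature of \<open>Num\<close> matter.\<close>

fun trans_val :: "translation \<Rightarrow> tm \<Rightarrow> nat \<Rightarrow> fm" where
  "trans_val I (Var y) x = at_vars (eq_of I) [y, x]"
| "trans_val I (Fun f []) x = at_vars (zero_of I) [x]"
| "trans_val I (Fun f [Var y]) x = at_vars (succ_of I) [y, x]"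
| "trans_val I (Fun f [t]) x =
     Ex (And (at_vars (dom_of I) [0])
        (And (trans_val I (lift_tm t) 0) (at_vars (succ_of I) [0, Suc x])))"
| "trans_val I (Fun f ts) x = Falsum"

fun trans :: "translation \<Rightarrow> fm \<Rightarrow> fm" where
  "trans I Falsum = Falsum"
| "trans I (Eq s (Var x)) = trans_val I s x"
| "trans I (Eq (Var x) t) = trans_val I t x"
| "trans I (Eq s t) =
     Ex (And (at_vars (dom_of I) [0])
        (And (trans_val I (lift_tm s) 0) (trans_val I (lift_tm t) 0)))"
| "trans I (Rel r ts) = Falsum"
| "trans I (Imp p q) = Imp (trans I p) (trans I q)"
| "trans I (All p) = All (Imp (at_vars (dom_of I) [0]) (trans I p))"

definition is_translation :: "signature \<Rightarrow> translation \<Rightarrow> bool" where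
  "is_translation L I \<longleftrightarrow>
     wf_fm L (dom_of I) \<and> fv (dom_of I) \<subseteq> {0} \<and>
     wf_fm L (eq_of I) \<and> fv (eq_of I) \<subseteq> {0, 1} \<and>
     wf_fm L (zero_of I) \<and> fv (zero_of I) \<subseteq> {0} \<and>
     wf_fm L (succ_of I) \<and> fv (succ_of I) \<subseteq> {0, 1}"

text \<open>The equality axioms for the language of \<open>Num\<close> are theorems of \<open>Num\<close>, since the calculus
  is one for logic with equality; hence the last clause also covers their translations.\<close>

definition interprets_Num :: "signature \<Rightarrow> fm set \<Rightarrow> translation \<Rightarrow> bool" where
  "interprets_Num L T I \<longleftrightarrow> is_translation L I \<and>
     T \<turnstile> Ex (And (at_vars (dom_of I) [0]) (at_vars (zero_of I) [0])) \<and>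
     T \<turnstile> All (Imp (at_vars (dom_of I) [0])
               (Ex (And (at_vars (dom_of I) [0]) (at_vars (succ_of I) [1, 0])))) \<and>
     (\<forall>p. wf_fm sig_Num p \<and> fv p = {} \<and> Num \<turnstile> p \<longrightarrow> T \<turnstile> trans I p)"

text \<open>For \<open>p(x_1, \<dots>, x_n)\<close>, with \<open>x_(i+1)\<close> being variable \<open>i\<close>, this is the sentence obtained by
  putting the translated numerals of the given numbers for \<open>x_1, \<dots>, x_n\<close>. A translated numeral
  is not a term but is given by a formula (the translation of \<open>numeral = x\<close>), so it is
  eliminated in the usual way by an existential quantifier over the domain:
  there are \<open>x_1, \<dots>, x_n\<close> in the domain that are the numerals and satisfy \<open>p\<close>.
  Propositional connectives are always applied outside of this sentence.\<close>

definition at_numerals :: "translation \<Rightarrow> fm \<Rightarrow> nat list \<Rightarrow> fm" where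
  "at_numerals I p as = (Ex ^^ length as)
     (foldr And
        (map (\<lambda>i. And (at_vars (dom_of I) [i]) (trans I (Eq (numeral_tm (as ! i)) (Var i))))
           [0..<length as]) p)"

section \<open>Separation\<close>

definition fm_with_vars :: "signature \<Rightarrow> nat \<Rightarrow> fm \<Rightarrow> bool" where
  "fm_with_vars L n p \<longleftrightarrow> wf_fm L p \<and> fv p = {..<n}"

definition strongly_separates ::
    "signature \<Rightarrow> fm set \<Rightarrow> translation \<Rightarrow> nat \<Rightarrow> fm \<Rightarrow> nat list set \<Rightarrow> nat list set \<Rightarrow> bool" where
  "strongly_separates L T I n p M1 M2 \<longleftrightarrow> fm_with_vars L n p \<and>
     (\<forall>as. length as = n \<longrightarrow>
        (as \<in> M1 \<longrightarrow> T \<turnstile> at_numerals I p as) \<and>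
        (as \<in> M2 \<longrightarrow> T \<turnstile> Neg (at_numerals I p as)))"

definition exactly_separates ::
    "signature \<Rightarrow> fm set \<Rightarrow> translation \<Rightarrow> nat \<Rightarrow> fm \<Rightarrow> nat list set \<Rightarrow> nat list set \<Rightarrow> bool" where
  "exactly_separates L T I n p M1 M2 \<longleftrightarrow> fm_with_vars L n p \<and>
     (\<forall>as. length as = n \<longrightarrow>
        (as \<in> M1 \<longleftrightarrow> T \<turnstile> at_numerals I p as) \<and>
        (as \<in> M2 \<longleftrightarrow> T \<turnstile> Neg (at_numerals I p as)))"

definition rosser_via :: "signature \<Rightarrow> fm set \<Rightarrow> nat \<Rightarrow> translation \<Rightarrow> bool" where
  "rosser_via L T n I \<longleftrightarrow> interprets_Num L T I \<and>
     (\<forall>M1 M2. RE n M1 \<and> RE n M2 \<longrightarrow>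
        (\<exists>p. strongly_separates L T I n p (M1 - M2) (M2 - M1)))"

definition exact_rosser :: "signature \<Rightarrow> fm set \<Rightarrow> nat \<Rightarrow> bool" where
  "exact_rosser L T n \<longleftrightarrow> (\<exists>I. interprets_Num L T I \<and>
     (\<forall>M1 M2. RE n M1 \<and> RE n M2 \<and> M1 \<inter> M2 = {} \<longrightarrow>
        (\<exists>p. exactly_separates L T I n p M1 M2)))"

text \<open>Admissibility of an \<open>n\<close>-ary functional \<open>F\<close> on \<open>m\<close>-tuples.\<close>

definition admissible ::
    "signature \<Rightarrow> fm set \<Rightarrow> translation \<Rightarrow> nat \<Rightarrow> nat \<Rightarrow> (nat list \<Rightarrow> nat list) \<Rightarrow> bool" where
  "admissible L T I m n F \<longleftrightarrow>
     (\<forall>p. fm_with_vars L n p \<longrightarrow> (\<exists>q. fm_with_vars L m q \<and>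
        (\<forall>as. length as = m \<longrightarrow> T \<turnstile> Iff (at_numerals I q as) (at_numerals I p (F as)))))"

end

theory Submission
  imports Defs
begin

text \<open>
  Given disjoint RE relations \<open>M1\<close>, \<open>M2\<close>, put \<open>y = J(h, x)\<close> and let \<open>A\<close> consist of the constant
  tuples \<open>(y, \<dots>, y)\<close> such that \<open>x \<in> M1\<close> or \<open>T\<close> refutes \<open>\<phi>\<^sub>h(y, \<dots>, y)\<close>, and \<open>B\<close> of those such that
  \<open>x \<in> M2\<close> or \<open>T\<close> proves \<open>\<phi>\<^sub>h(y, \<dots>, y)\<close>, where \<open>\<phi>\<^sub>h\<close> is the formula with Goedel number \<open>h\<close>. If \<open>p\<close>
  strongly separates \<open>A - B\<close> from \<open>B - A\<close> and \<open>h\<close> is the Goedel number of \<open>p\<close> itself, then consistency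
  of \<open>T\<close> forces \<open>p(y, \<dots>, y)\<close> to be provable exactly when \<open>x \<in> M1\<close> and refutable exactly when
  \<open>x \<in> M2\<close>; admissibility turns \<open>p(J(h, x), \<dots>, J(h, x))\<close> into a formula in \<open>x\<close>.

  The remaining work is to show that \<open>A\<close> and \<open>B\<close> are RE, that is, to arithmetise provability.
  Substitution and provability are treated as closures under finitary semidecidable rules, which are
  semidecidable because derivations can be searched for.
\<close>

section \<open>Total recursive functions\<close>

text \<open>The arity \<open>n\<close> compensates for untyped programs: values of \<open>F\<close>
  on lists of other lengths are arbitrary.\<close>

definition total_rec :: "nat \<Rightarrow> (nat list \<Rightarrow> nat) \<Rightarrow> bool" where
  "total_rec n F \<longleftrightarrow> (\<exists>f. \<forall>xs. length xs = n \<longrightarrow> rec_eval f xs (F xs))"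

lemma total_rec_const: "total_rec n (\<lambda>_. c)"
proof (induction c)
  case 0
  show ?case unfolding total_rec_def by (blast intro: rec_eval.Zero)
next
  case (Suc c)
  then obtain f where "\<forall>xs. length xs = n \<longrightarrow> rec_eval f xs c" by (auto simp: total_rec_def)
  then have "\<forall>xs. length xs = n \<longrightarrow> rec_eval (Comp Succ [f]) xs (Suc c)"
    by (auto intro!: rec_eval.Comp[where ys = "[c]"] rec_eval.Succ)
  then show ?case unfolding total_rec_def by blast
qed

lemma total_rec_nth: "i < n \<Longrightarrow> total_rec n (\<lambda>xs. xs ! i)"
  unfolding total_rec_def by (intro exI[of _ "Proj i"]) (auto intro: rec_eval.Proj)

lemma total_rec_Suc: "total_rec n F \<Longrightarrow> total_rec n (\<lambda>xs. Suc (F xs))"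
proof -
  assume "total_rec n F"
  then obtain f where "\<forall>xs. length xs = n \<longrightarrow> rec_eval f xs (F xs)" by (auto simp: total_rec_def)
  then have "\<forall>xs. length xs = n \<longrightarrow> rec_eval (Comp Succ [f]) xs (Suc (F xs))"
    by (auto intro!: rec_eval.Comp[where ys = "[F _]"] rec_eval.Succ)
  then show ?thesis unfolding total_rec_def by blast
qed

lemma total_rec_comp1:
  assumes "total_rec 1 F" and "total_rec n G"
  shows "total_rec n (\<lambda>xs. F [G xs])"
proof -
  obtain f g where f: "\<forall>xs. length xs = 1 \<longrightarrow> rec_eval f xs (F xs)"
    and g: "\<forall>xs. length xs = n \<longrightarrow> rec_eval g xs (G xs)"
    using assms by (auto simp: total_rec_def)
  have "\<forall>xs. length xs = n \<longrightarrow> rec_eval (Comp f [g]) xs (F [G xs])"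
    using f g by (auto intro!: rec_eval.Comp[where ys = "[G _]"])
  then show ?thesis unfolding total_rec_def by blast
qed

lemma total_rec_comp2:
  assumes "total_rec 2 F" and "total_rec n G" and "total_rec n H"
  shows "total_rec n (\<lambda>xs. F [G xs, H xs])"
proof -
  obtain f g h where f: "\<forall>xs. length xs = 2 \<longrightarrow> rec_eval f xs (F xs)"
    and g: "\<forall>xs. length xs = n \<longrightarrow> rec_eval g xs (G xs)"
    and h: "\<forall>xs. length xs = n \<longrightarrow> rec_eval h xs (H xs)"
    using assms by (auto simp: total_rec_def)
  have "\<forall>xs. length xs = n \<longrightarrow> rec_eval (Comp f [g, h]) xs (F [G xs, H xs])"
    using f g h by (auto intro!: rec_eval.Comp[where ys = "[G _, H _]"])
  then show ?thesis unfolding total_rec_def by blast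
qed

text \<open>A single parameter \<open>xs ! 1\<close> suffices, because
  \<open>computable_rec_nat\<close> later packs all parameters into one code.\<close>

lemma total_rec_primrec:
  assumes "total_rec 1 B" and "total_rec 3 S"
  shows "total_rec 2 (\<lambda>xs. rec_nat (B [xs ! 1]) (\<lambda>k r. S [k, r, xs ! 1]) (xs ! 0))"
proof -
  obtain f g where f: "\<forall>xs. length xs = 1 \<longrightarrow> rec_eval f xs (B xs)"
    and g: "\<forall>xs. length xs = 3 \<longrightarrow> rec_eval g xs (S xs)"
    using assms by (auto simp: total_rec_def)
  have "rec_eval (PrimRec f g) [k, x] (rec_nat (B [x]) (\<lambda>k r. S [k, r, x]) k)" for k x
    using f g by (induction k) (auto intro: rec_eval.PrimRec_0 rec_eval.PrimRec_Suc)
  then have "\<forall>xs. length xs = 2 \<longrightarrow> rec_eval (PrimRec f g) xs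
      (rec_nat (B [xs ! 1]) (\<lambda>k r. S [k, r, xs ! 1]) (xs ! 0))"
    by (auto simp: numeral_2_eq_2 length_Suc_conv)
  then show ?thesis unfolding total_rec_def by blast
qed

text \<open>Minimisation stays total: a zero is assumed to exist, and since \<open>F\<close> is
  total every earlier value is defined and, being nonzero, a successor.\<close>

lemma total_rec_Least:
  assumes "total_rec (Suc n) F" and ex: "\<And>xs. length xs = n \<Longrightarrow> \<exists>k. F (k # xs) = 0"
  shows "total_rec n (\<lambda>xs. LEAST k. F (k # xs) = 0)"
proof -
  obtain f where f: "\<forall>xs. length xs = Suc n \<longrightarrow> rec_eval f xs (F xs)"
    using assms by (auto simp: total_rec_def)
  have "rec_eval (Mu f) xs (LEAST k. F (k # xs) = 0)" if "length xs = n" for xs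
  proof (rule rec_eval.Mu)
    have "F ((LEAST k. F (k # xs) = 0) # xs) = 0"
      using ex[OF that] by (rule LeastI_ex)
    then show "rec_eval f ((LEAST k. F (k # xs) = 0) # xs) 0"
      using f that by (metis length_Cons)
    fix j assume "j < (LEAST k. F (k # xs) = 0)"
    then have "F (j # xs) \<noteq> 0" by (rule not_less_Least)
    then show "\<exists>y. rec_eval f (j # xs) (Suc y)"
      using f that by (metis length_Cons not0_implies_Suc)
  qed
  then show ?thesis unfolding total_rec_def by blast
qed

section \<open>Arithmetic and the Cantor pairing\<close>

lemma total_rec_add:
  assumes "total_rec n F" and "total_rec n G"
  shows "total_rec n (\<lambda>xs. F xs + G xs)"
proof -
  have "rec_nat x (\<lambda>_ r. Suc r) k = k + x" for k x :: nat by (induction k) auto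
  then have "total_rec 2 (\<lambda>xs. xs ! 0 + xs ! 1)"
    using total_rec_primrec[of "\<lambda>xs. xs ! 0" "\<lambda>xs. Suc (xs ! 1)"]
    by (simp add: total_rec_nth total_rec_Suc)
  from total_rec_comp2[OF this assms] show ?thesis by simp
qed

lemma total_rec_diff:
  assumes "total_rec n F" and "total_rec n G"
  shows "total_rec n (\<lambda>xs. F xs - G xs)"
proof -
  \<comment> \<open>Returning the counter and ignoring the previous value gives the
    predecessor.\<close>
  have "rec_nat 0 (\<lambda>k _. k) k = k - 1" for k :: nat by (cases k) auto
  then have "total_rec 2 (\<lambda>xs. xs ! 0 - 1)"
    using total_rec_primrec[of "\<lambda>_. 0" "\<lambda>xs. xs ! 0"]
    by (simp add: total_rec_nth total_rec_const)
  from total_rec_comp2[OF this total_rec_nth[of 1 3] total_rec_const[of 3 0]]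
  have pred: "total_rec 3 (\<lambda>xs. xs ! 1 - 1)" by simp
  \<comment> \<open>The recursion runs over the subtrahend, which therefore comes first; the
    arguments are swapped at the end.\<close>
  have "rec_nat x (\<lambda>_ r. r - 1) k = x - k" for k x :: nat by (induction k) auto
  then have "total_rec 2 (\<lambda>xs. xs ! 1 - xs ! 0)"
    using total_rec_primrec[of "\<lambda>xs. xs ! 0", OF _ pred] by (simp add: total_rec_nth)
  from total_rec_comp2[OF this assms(2,1)] show ?thesis by simp
qed

lemma total_rec_triangle:
  assumes "total_rec n F"
  shows "total_rec n (\<lambda>xs. triangle (F xs))"
proof -
  have "rec_nat 0 (\<lambda>k r. r + Suc k) k = triangle k" for k :: nat by (induction k) auto
  then have "total_rec 2 (\<lambda>xs. triangle (xs ! 0))"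
    using total_rec_primrec[of "\<lambda>_. 0" "\<lambda>xs. xs ! 1 + Suc (xs ! 0)"]
    by (simp add: total_rec_nth total_rec_const total_rec_Suc total_rec_add)
  from total_rec_comp2[OF this assms assms] show ?thesis by simp
qed

lemma total_rec_prod_encode:
  assumes "total_rec n F" and "total_rec n G"
  shows "total_rec n (\<lambda>xs. prod_encode (F xs, G xs))"
  unfolding prod_encode_def using assms by (simp add: total_rec_add total_rec_triangle)

lemma triangle_mono: "m \<le> n \<Longrightarrow> triangle m \<le> triangle n"
  by (induction rule: dec_induct) auto

text \<open>Since \<open>prod_encode (a, b)\<close> is \<open>triangle (a + b) + a\<close>, it lies
  below \<open>triangle (Suc (a + b))\<close> but not below \<open>triangle (a + b)\<close>.\<close>

lemma Least_triangle: "(LEAST s. Suc (prod_encode (a, b)) - triangle (Suc s) = 0) = a + b"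
proof (rule Least_equality)
  show "Suc (prod_encode (a, b)) - triangle (Suc (a + b)) = 0" by (simp add: prod_encode_def)
  fix s assume s: "Suc (prod_encode (a, b)) - triangle (Suc s) = 0"
  show "a + b \<le> s"
  proof (rule ccontr)
    assume "\<not> a + b \<le> s"
    then have "triangle (Suc s) \<le> triangle (a + b)" by (intro triangle_mono) simp
    with s show False by (simp add: prod_encode_def)
  qed
qed

text \<open>The Cantor diagonal that contains the pair coded by \<open>z\<close>. The condition
  \<open>z < triangle (Suc s)\<close> is put as a vanishing truncated difference to suit
  minimisation.\<close>

definition diag_index :: "nat \<Rightarrow> nat" where
  "diag_index z = (LEAST s. Suc z - triangle (Suc s) = 0)"

lemma prod_decode_diag_index:
  "fst (prod_decode z) = z - triangle (diag_index z)"
  "snd (prod_decode z) = diag_index z - (z - triangle (diag_index z))"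
proof -
  obtain a b where ab: "z = prod_encode (a, b)"
    by (metis prod_decode_inverse surj_pair)
  moreover have "diag_index z = a + b" unfolding diag_index_def ab by (rule Least_triangle)
  ultimately show "fst (prod_decode z) = z - triangle (diag_index z)"
    "snd (prod_decode z) = diag_index z - (z - triangle (diag_index z))"
    using ab by (simp_all, simp_all add: prod_encode_def)
qed

lemma total_rec_diag_index:
  assumes "total_rec n F"
  shows "total_rec n (\<lambda>xs. diag_index (F xs))"
proof -
  have "total_rec 1 (\<lambda>xs. LEAST k. Suc ((k # xs) ! 1) - triangle (Suc ((k # xs) ! 0)) = 0)"
  proof (rule total_rec_Least)
    show "total_rec (Suc 1) (\<lambda>xs. Suc (xs ! 1) - triangle (Suc (xs ! 0)))"
      by (intro total_rec_diff total_rec_Suc total_rec_triangle total_rec_nth) auto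
    fix xs :: "nat list"
    \<comment> \<open>This bounds the search: the code itself is already a large enough
      candidate.\<close>
    have "k \<le> triangle k" for k by (induction k) auto
    then show "\<exists>k. Suc ((k # xs) ! 1) - triangle (Suc ((k # xs) ! 0)) = 0"
      by (intro exI[of _ "xs ! 0"]) (simp add: le_diff_conv)
  qed
  then have "total_rec 1 (\<lambda>xs. diag_index (xs ! 0))" by (simp add: diag_index_def)
  from total_rec_comp1[OF this assms] show ?thesis by simp
qed

lemma total_rec_prod_decode:
  assumes "total_rec n F"
  shows "total_rec n (\<lambda>xs. fst (prod_decode (F xs)))" "total_rec n (\<lambda>xs. snd (prod_decode (F xs)))"
  unfolding prod_decode_diag_index
  using assms by (auto intro!: total_rec_diff total_rec_triangle total_rec_diag_index)

text \<open>For fixed length the code is a nest of \<open>n\<close> pairings, built from the last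
  entry backwards. It lets an \<open>n\<close>-ary program call a unary one on codes.\<close>

lemma total_rec_list_encode: "total_rec n list_encode"
proof -
  have "total_rec n (\<lambda>xs. list_encode (drop (n - k) xs))" if "k \<le> n" for k
    using that
  proof (induction k)
    case 0
    obtain f where f: "\<And>xs. length xs = n \<Longrightarrow> rec_eval f xs 0"
      using total_rec_const[of n 0] by (auto simp: total_rec_def)
    show ?case unfolding total_rec_def using f by (intro exI[of _ f]) auto
  next
    case (Suc k)
    have eq: "list_encode (drop (n - Suc k) xs) =
        Suc (prod_encode (xs ! (n - Suc k), list_encode (drop (n - k) xs)))" if "length xs = n" for xs
      using that Suc.prems by (subst Cons_nth_drop_Suc[symmetric]) (auto simp: Suc_diff_Suc)
    have "total_rec n (\<lambda>xs. Suc (prod_encode (xs ! (n - Suc k), list_encode (drop (n - k) xs))))"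
      using Suc by (intro total_rec_Suc total_rec_prod_encode total_rec_nth Suc.IH) auto
    then show ?case unfolding total_rec_def by (metis eq)
  qed
  from this[of n] show ?thesis by simp
qed

text \<open>In the case of \<open>Mu\<close>, the smaller of two different results would give both
  zero and a successor at the same argument.\<close>

lemma rec_eval_deterministic: "rec_eval f xs y \<Longrightarrow> rec_eval f xs z \<Longrightarrow> y = z"
proof (induction arbitrary: z rule: rec_eval.induct)
  case (Comp xs gs ys f y)
  from Comp.prems obtain ys' where ys': "list_all2 (\<lambda>g. rec_eval g xs) gs ys'" "rec_eval f ys' z"
    by cases auto
  have "ys = ys'"
    using Comp.IH(1) ys'(1) by (auto simp: list_all2_conv_all_nth intro!: nth_equalityI)
  with ys' Comp.IH(2) show ?case by blast
next
  case (PrimRec_Suc f g k xs r y)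
  from PrimRec_Suc.prems show ?case
    by cases (use PrimRec_Suc.IH in blast)
next
  case (Mu f k xs)
  from Mu.prems obtain 0: "rec_eval f (z # xs) 0" "\<And>j. j < z \<Longrightarrow> \<exists>y. rec_eval f (j # xs) (Suc y)"
    by cases auto
  show ?case
  proof (cases k z rule: linorder_cases)
    case less
    with 0(2) Mu.IH(1) show ?thesis by blast
  next
    case greater
    with 0(1) Mu.IH(2) show ?thesis by blast
  qed
next
  case (Zero xs)
  then show ?case by cases simp
next
  case (Succ x)
  then show ?case by cases simp
next
  case (Proj i xs)
  from Proj.prems show ?case by cases simp
next
  case (PrimRec_0 f xs y g)
  from PrimRec_0.prems show ?case by cases (use PrimRec_0.IH in blast)
qed

section \<open>Computability on encodable types\<close>

text \<open>Only injectivity is required, because not every number is the Goedel number of a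
  formula.\<close>

class encodable =
  fixes enc :: "'a \<Rightarrow> nat"
  assumes enc_inject: "enc x = enc y \<Longrightarrow> x = y"

lemma enc_eq_iff [simp]: "enc x = enc y \<longleftrightarrow> x = y"
  using enc_inject by blast

instantiation nat :: encodable
begin

definition "enc (x :: nat) = x"

instance by standard (simp add: enc_nat_def)

end

instantiation prod :: (encodable, encodable) encodable
begin

definition "enc p = prod_encode (enc (fst p), enc (snd p))"

instance by standard (simp add: enc_prod_def prod_eq_iff)

end

instantiation list :: (encodable) encodable
begin

definition "enc xs = list_encode (map enc xs)"

instance
proof
  fix xs ys :: "'a list"
  assume "enc xs = enc ys"
  then have "map enc xs = map enc ys" by (simp add: enc_list_def list_encode_eq)
  then show "xs = ys" by (simp add: inj_map_eq_map inj_def)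
qed

end

lemma enc_simps [simp]:
  "enc (n :: nat) = n"
  "enc (x, y) = prod_encode (enc x, enc y)"
  "enc ([] :: 'a::encodable list) = 0"
  "enc (a # xs) = Suc (prod_encode (enc a, enc xs))"
  by (simp_all add: enc_nat_def enc_prod_def enc_list_def)

text \<open>\<open>F\<close> is total on all numbers, also on those that are not codes; a search through candidate codes
  may therefore evaluate it before it knows whether the candidate is a code.\<close>

definition computable :: "('a::encodable \<Rightarrow> 'b::encodable) \<Rightarrow> bool" where
  "computable f \<longleftrightarrow> (\<exists>F. total_rec 1 (\<lambda>xs. F (xs ! 0)) \<and> (\<forall>a. F (enc a) = enc (f a)))"

lemma computable_ident: "computable (\<lambda>x. x)"
  unfolding computable_def by (rule exI[of _ "\<lambda>x. x"]) (simp add: total_rec_nth)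

lemma computable_const: "computable (\<lambda>x. c)"
  unfolding computable_def by (rule exI[of _ "\<lambda>x. enc c"]) (simp add: total_rec_const)

lemma computable_compose: "computable f \<Longrightarrow> computable g \<Longrightarrow> computable (\<lambda>x. f (g x))"
proof -
  assume "computable f" "computable g"
  then obtain F G where
    F: "total_rec 1 (\<lambda>xs. F (xs ! 0))" "\<And>a. F (enc a) = enc (f a)" and
    G: "total_rec 1 (\<lambda>xs. G (xs ! 0))" "\<And>a. G (enc a) = enc (g a)"
    by (auto simp: computable_def)
  have "total_rec 1 (\<lambda>xs. F (G (xs ! 0)))" using total_rec_comp1[OF F(1) G(1)] by simp
  then show ?thesis unfolding computable_def
    by (intro exI[of _ "\<lambda>x. F (G x)"]) (simp add: F G)
qed

lemma computable_enc: "computable f \<Longrightarrow> computable (\<lambda>x. enc (f x))"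
  by (simp add: computable_def)

text \<open>Computability speaks of codes only, so that of a constructor reduces to arithmetic on
  codes.\<close>

lemma computable_encD: "computable (\<lambda>x. enc (f x)) \<Longrightarrow> computable f"
  by (simp add: computable_def)

lemma computable_Pair: "computable f \<Longrightarrow> computable g \<Longrightarrow> computable (\<lambda>x. (f x, g x))"
proof -
  assume "computable f" "computable g"
  then obtain F G where
    F: "total_rec 1 (\<lambda>xs. F (xs ! 0))" "\<And>a. F (enc a) = enc (f a)" and
    G: "total_rec 1 (\<lambda>xs. G (xs ! 0))" "\<And>a. G (enc a) = enc (g a)"
    by (auto simp: computable_def)
  then show ?thesis unfolding computable_def
    by (intro exI[of _ "\<lambda>x. prod_encode (F x, G x)"])
      (simp add: total_rec_prod_encode)
qed

lemma computable_fst: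
  fixes f :: "'a::encodable \<Rightarrow> 'b::encodable \<times> 'c::encodable"
  assumes "computable f"
  shows "computable (\<lambda>x. fst (f x))"
proof (rule computable_compose[of fst, OF _ assms])
  show "computable (fst :: 'b \<times> 'c \<Rightarrow> 'b)" unfolding computable_def
    by (rule exI[of _ "\<lambda>z. fst (prod_decode z)"])
      (simp add: total_rec_prod_decode total_rec_nth)
qed

lemma computable_snd:
  fixes f :: "'a::encodable \<Rightarrow> 'b::encodable \<times> 'c::encodable"
  assumes "computable f"
  shows "computable (\<lambda>x. snd (f x))"
proof (rule computable_compose[of snd, OF _ assms])
  show "computable (snd :: 'b \<times> 'c \<Rightarrow> 'c)" unfolding computable_def
    by (rule exI[of _ "\<lambda>z. snd (prod_decode z)"])
      (simp add: total_rec_prod_decode total_rec_nth)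
qed

lemma computable_Suc: "computable f \<Longrightarrow> computable (\<lambda>x. Suc (f x))"
proof (rule computable_compose[of Suc])
  show "computable Suc" unfolding computable_def
    by (rule exI[of _ Suc]) (simp add: total_rec_Suc total_rec_nth)
qed

lemma computable_nat_op:
  fixes f g :: "'a::encodable \<Rightarrow> nat"
  assumes op: "\<And>F G. total_rec 1 F \<Longrightarrow> total_rec 1 G \<Longrightarrow> total_rec 1 (\<lambda>xs. H (F xs) (G xs))"
    and "computable f" "computable g"
  shows "computable (\<lambda>x. H (f x) (g x))"
proof -
  obtain F G where
    F: "total_rec 1 (\<lambda>xs. F (xs ! 0))" "\<And>a. F (enc a) = f a" and
    G: "total_rec 1 (\<lambda>xs. G (xs ! 0))" "\<And>a. G (enc a) = g a"
    using assms by (auto simp: computable_def enc_nat_def)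
  then show ?thesis unfolding computable_def
    by (intro exI[of _ "\<lambda>x. H (F x) (G x)"]) (use op[OF F(1) G(1)] in simp)
qed

lemma computable_add:
  fixes f g :: "'a::encodable \<Rightarrow> nat"
  shows "computable f \<Longrightarrow> computable g \<Longrightarrow> computable (\<lambda>x. f x + g x)"
  by (rule computable_nat_op) (rule total_rec_add)

lemma computable_diff:
  fixes f g :: "'a::encodable \<Rightarrow> nat"
  shows "computable f \<Longrightarrow> computable g \<Longrightarrow> computable (\<lambda>x. f x - g x)"
  by (rule computable_nat_op) (rule total_rec_diff)

lemma computable_prod_encode:
  fixes f g :: "'a::encodable \<Rightarrow> nat"
  shows "computable f \<Longrightarrow> computable g \<Longrightarrow> computable (\<lambda>x. prod_encode (f x, g x))"
  by (rule computable_nat_op) (rule total_rec_prod_encode)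

text \<open>Parameter, counter and accumulator are packed into one number for the unary step
  function; an induction shows that the recursion on codes simulates the one on values.\<close>

lemma computable_rec_nat:
  fixes N :: "'a::encodable \<Rightarrow> nat" and B :: "'a \<Rightarrow> 'b::encodable"
  assumes "computable B" and "computable (\<lambda>p. S (fst p) (fst (snd p)) (snd (snd p)))" and "computable N"
  shows "computable (\<lambda>x. rec_nat (B x) (S x) (N x))"
proof -
  obtain F where F: "total_rec 1 (\<lambda>xs. F (xs ! 0))" "\<And>a. F (enc a) = enc (B a)"
    using assms(1) unfolding computable_def by blast
  obtain G where G: "total_rec 1 (\<lambda>xs. G (xs ! 0))"
      "\<And>p. G (enc p) = enc (S (fst p) (fst (snd p)) (snd (snd p)))"
    using assms(2) unfolding computable_def by blast
  have G': "G (prod_encode (enc x, prod_encode (k, enc r))) = enc (S x k r)" for x k r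
    using G(2)[of "(x, k, r)"] by simp
  obtain H where H: "total_rec 1 (\<lambda>xs. H (xs ! 0))" "\<And>a. H (enc a) = enc (N a)"
    using assms(3) unfolding computable_def by blast
  let ?S = "\<lambda>xs. G (prod_encode (xs ! 2, prod_encode (xs ! 0, xs ! 1)))"
  have "total_rec 3 ?S"
    using total_rec_comp1[OF G(1), of 3 "\<lambda>xs. prod_encode (xs ! 2, prod_encode (xs ! 0, xs ! 1))"]
    by (simp add: total_rec_prod_encode total_rec_nth)
  from total_rec_comp2[OF total_rec_primrec[OF F(1) this] H(1) total_rec_nth[of 0 1]]
  have 1: "total_rec 1 (\<lambda>xs. rec_nat (F (xs ! 0)) (\<lambda>k r. G (prod_encode (xs ! 0, prod_encode (k, r)))) (H (xs ! 0)))"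
    by simp
  have "rec_nat (F (enc a)) (\<lambda>k r. G (prod_encode (enc a, prod_encode (k, r)))) n = enc (rec_nat (B a) (S a) n)"
    for a n by (induction n) (simp_all add: F G')
  with 1 show ?thesis unfolding computable_def
    by (intro exI[of _ "\<lambda>x. rec_nat (F x) (\<lambda>k r. G (prod_encode (x, prod_encode (k, r)))) (H x)"])
      (simp add: H)
qed

lemma computable_Cons: "computable f \<Longrightarrow> computable g \<Longrightarrow> computable (\<lambda>x. f x # g x)"
  by (rule computable_encD) (simp add: computable_Suc computable_prod_encode computable_enc)

lemmas computable_intros = computable_const computable_ident computable_Pair computable_fst
  computable_snd computable_Suc computable_enc computable_Cons computable_add computable_diff

section \<open>Semidecidable predicates\<close>

text \<open>A Sigma-1 form: \<open>z\<close> is a witness, and the total computable \<open>F\<close>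
  checks it by returning zero, so that a witness can be found by minimisation.\<close>

definition enumerates :: "(nat \<Rightarrow> 'a::encodable \<Rightarrow> nat) \<Rightarrow> ('a \<Rightarrow> bool) \<Rightarrow> bool" where
  "enumerates F P \<longleftrightarrow> computable (\<lambda>p. F (fst p) (snd p)) \<and> (\<forall>x. P x \<longleftrightarrow> (\<exists>z. F z x = 0))"

definition semi :: "('a::encodable \<Rightarrow> bool) \<Rightarrow> bool" where
  "semi P \<longleftrightarrow> (\<exists>F. enumerates F P)"

lemma enumeratesD:
  assumes "enumerates F P"
  shows "computable (\<lambda>p. F (fst p) (snd p))" and "P x \<longleftrightarrow> (\<exists>z. F z x = 0)"
  using assms by (auto simp: enumerates_def)

lemma semiI:
  assumes "computable (\<lambda>p. F (fst p) (snd p))" and "\<And>x. P x \<longleftrightarrow> (\<exists>z::nat. F z x = (0::nat))"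
  shows "semi P"
  unfolding semi_def enumerates_def using assms by (intro exI[of _ F]) simp

lemma semi_cong: "semi Q \<Longrightarrow> (\<And>x. P x \<longleftrightarrow> Q x) \<Longrightarrow> semi P"
  by presburger

lemma computable_compose2:
  assumes "computable (\<lambda>p. F (fst p) (snd p))" and "computable f" and "computable g"
  shows "computable (\<lambda>x. F (f x) (g x))"
  using computable_compose[OF assms(1) computable_Pair[OF assms(2,3)]] by simp

lemma semi_compose:
  assumes "semi P" and "computable f"
  shows "semi (\<lambda>x. P (f x))"
proof -
  from assms(1) obtain F where "enumerates F P" unfolding semi_def by blast
  note F = enumeratesD[OF this]
  show ?thesis
    by (rule semiI[where F = "\<lambda>z x. F z (f x)"])
      (intro computable_compose2[OF F(1)] computable_intros computable_compose[OF assms(2)], rule F(2))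
qed

text \<open>Both truncated differences vanish exactly when the two numbers agree.\<close>

lemma semi_eq_nat:
  fixes f g :: "'a::encodable \<Rightarrow> nat"
  shows "computable f \<Longrightarrow> computable g \<Longrightarrow> semi (\<lambda>x. f x = g x)"
  by (rule semiI[where F = "\<lambda>_ x. (f x - g x) + (g x - f x)"])
    (auto intro!: computable_intros computable_compose[of f] computable_compose[of g])

lemma semi_eq: "computable f \<Longrightarrow> computable g \<Longrightarrow> semi (\<lambda>x. f x = g x)"
  using semi_eq_nat[of "\<lambda>x. enc (f x)" "\<lambda>x. enc (g x)"] by (simp add: computable_enc)

lemma semi_less:
  fixes f g :: "'a::encodable \<Rightarrow> nat"
  shows "computable f \<Longrightarrow> computable g \<Longrightarrow> semi (\<lambda>x. f x < g x)"
  by (rule semiI[where F = "\<lambda>_ x. Suc (f x) - g x"])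
    (auto intro!: computable_intros computable_compose[of f] computable_compose[of g])

lemma semi_disj: "semi P \<Longrightarrow> semi Q \<Longrightarrow> semi (\<lambda>x. P x \<or> Q x)"
proof -
  assume "semi P" "semi Q"
  then obtain F G where "enumerates F P" "enumerates G Q" unfolding semi_def by blast
  note F = enumeratesD[OF this(1)] and G = enumeratesD[OF this(2)]
  \<comment> \<open>With truncated subtraction, \<open>a - (a - b)\<close> is the minimum of \<open>a\<close> and \<open>b\<close>.\<close>
  show ?thesis
  proof (rule semiI[where F = "\<lambda>z x. F z x - (F z x - G z x)"])
    show "computable (\<lambda>p. F (fst p) (snd p) - (F (fst p) (snd p) - G (fst p) (snd p)))"
      by (intro computable_intros computable_compose2[OF F(1)] computable_compose2[OF G(1)])
    have "a - (a - b) = 0 \<longleftrightarrow> a = 0 \<or> b = 0" for a b :: nat by auto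
    then show "P x \<or> Q x \<longleftrightarrow> (\<exists>z. F z x - (F z x - G z x) = 0)" for x
      by (simp only: F(2) G(2)) blast
  qed
qed

text \<open>The code of a pair of numbers is its \<open>prod_encode\<close>, so on codes this is the
  identity.\<close>

lemma computable_prod_decode: "computable prod_decode"
  unfolding computable_def
  by (rule exI[of _ "\<lambda>x. x"]) (simp add: total_rec_nth enc_prod_def)

text \<open>The two conjuncts may have different witnesses, so a witness for both is a coded
  pair.\<close>

lemma semi_conj: "semi P \<Longrightarrow> semi Q \<Longrightarrow> semi (\<lambda>x. P x \<and> Q x)"
proof -
  assume "semi P" "semi Q"
  then obtain F G where "enumerates F P" "enumerates G Q" unfolding semi_def by blast
  note F = enumeratesD[OF this(1)] and G = enumeratesD[OF this(2)]
  let ?F = "\<lambda>z x. F (fst (prod_decode z)) x + G (snd (prod_decode z)) x"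
  show ?thesis
  proof (rule semiI[where F = ?F])
    show "computable (\<lambda>p. ?F (fst p) (snd p))"
      by (intro computable_intros computable_compose2[OF F(1)] computable_compose2[OF G(1)] computable_compose[OF computable_prod_decode])
    have "(\<exists>z. ?F z x = 0) \<longleftrightarrow> (\<exists>a b. F a x = 0 \<and> G b x = 0)" for x
      by (metis add_is_0 fst_conv snd_conv prod_encode_inverse)
    then show "P x \<and> Q x \<longleftrightarrow> (\<exists>z. ?F z x = 0)" for x
      using F(2) G(2) by simp
  qed
qed

lemma semi_const: "semi (\<lambda>x. b)"
  by (rule semiI[where F = "\<lambda>_ _. if b then 0 else 1"]) (auto intro: computable_const)

text \<open>Quantifying over a type amounts to searching through its codes, so these have to be
  recognised.\<close>

class re_type = encodable +
  assumes semi_range: "semi (\<lambda>c. c \<in> range (enc :: 'a \<Rightarrow> nat))"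

lemma semi_ex:
  fixes P :: "'a::encodable \<Rightarrow> 'b::re_type \<Rightarrow> bool"
  assumes "semi (\<lambda>p. P (fst p) (snd p))"
  shows "semi (\<lambda>x. \<exists>y. P x y)"
proof -
  obtain F where "enumerates F (\<lambda>p. P (fst p) (snd p))"
    using assms unfolding semi_def by blast
  note F = enumeratesD[OF this]
  from F(1) obtain G where G: "total_rec 1 (\<lambda>xs. G (xs ! 0))"
      "\<And>z x y. G (prod_encode (z, prod_encode (enc x, enc y))) = F z (x, y)"
    by (auto simp: computable_def)
  then have G': "computable G" by (auto simp: computable_def)
  obtain R where "enumerates R (\<lambda>c. c \<in> range (enc :: 'b \<Rightarrow> nat))"
    using semi_range[where 'a = 'b] unfolding semi_def by blast
  note R = enumeratesD[OF this]
  \<comment> \<open>A witness is a triple: \<open>c\<close> is the candidate code, \<open>w\<close>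
    certifies that it is a code, and \<open>z\<close> witnesses \<open>P\<close>. The sum vanishes
    only if both checks succeed.\<close>
  let ?H = "\<lambda>w z c x. R w c + G (prod_encode (z, prod_encode (enc x, c)))"
  let ?F = "\<lambda>s x. ?H (fst (prod_decode s)) (fst (prod_decode (snd (prod_decode s))))
    (snd (prod_decode (snd (prod_decode s)))) x"
  show ?thesis
  proof (rule semiI[where F = ?F])
    show "computable (\<lambda>p. ?F (fst p) (snd p))"
      by (intro computable_intros computable_compose2[OF R(1)] computable_compose[OF G'] computable_prod_encode
        computable_compose[OF computable_prod_decode])
    show "(\<exists>y. P x y) \<longleftrightarrow> (\<exists>s. ?F s x = 0)" for x
    proof
      assume "\<exists>y. P x y"
      then obtain y z where "F z (x, y) = 0" using F(2)[of "(x, _)"] by auto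
      moreover obtain w where "R w (enc y) = 0" using R(2) by blast
      ultimately have "?F (prod_encode (w, prod_encode (z, enc y))) x = 0" by (simp add: G)
      then show "\<exists>s. ?F s x = 0" ..
    next
      assume "\<exists>s. ?F s x = 0"
      then obtain s where "?F s x = 0" ..
      moreover define w z c where "w = fst (prod_decode s)" and "z = fst (prod_decode (snd (prod_decode s)))"
        and "c = snd (prod_decode (snd (prod_decode s)))"
      ultimately have "?H w z c x = 0" by simp
      moreover from this obtain y :: 'b where "c = enc y" using R(2)[of c] by auto
      ultimately show "\<exists>y. P x y" using F(2)[of "(x, y)"] G(2) by auto
    qed
  qed
qed

instance nat :: re_type
proof
  show "semi (\<lambda>c. c \<in> range (enc :: nat \<Rightarrow> nat))"
    by (simp add: image_def semi_const)
qed

lemmas semi_intros = semi_const semi_disj semi_conj semi_eq semi_less semi_ex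

instance prod :: (re_type, re_type) re_type
proof
  have "semi (\<lambda>c. \<exists>a b :: nat. c = prod_encode (a, b) \<and> a \<in> range (enc :: 'a \<Rightarrow> nat) \<and> b \<in> range (enc :: 'b \<Rightarrow> nat))"
    by (intro semi_intros computable_intros computable_prod_encode
      semi_compose[OF semi_range[where 'a = 'a]] semi_compose[OF semi_range[where 'a = 'b]])
  moreover have "c \<in> range (enc :: 'a \<times> 'b \<Rightarrow> nat) \<longleftrightarrow>
     (\<exists>a b :: nat. c = prod_encode (a, b) \<and> a \<in> range (enc :: 'a \<Rightarrow> nat) \<and> b \<in> range (enc :: 'b \<Rightarrow> nat))" for c
    by (force simp: image_def)
  ultimately show "semi (\<lambda>c. c \<in> range (enc :: 'a \<times> 'b \<Rightarrow> nat))" by simp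
qed

section \<open>Coded sequences and bounded quantification\<close>

definition seq_nth :: "nat \<Rightarrow> nat \<Rightarrow> nat" where
  "seq_nth s i = fst (prod_decode (rec_nat s (\<lambda>_ r. snd (prod_decode r)) i))"

lemma computable_seq_nth: "computable f \<Longrightarrow> computable g \<Longrightarrow> computable (\<lambda>x. seq_nth (f x) (g x))"
  unfolding seq_nth_def
  by (intro computable_intros computable_compose[OF computable_prod_decode] computable_rec_nat)

text \<open>The counterpart of Goedel's beta function lemma. Every number codes an infinite sequence
  by iterated second projections, so prescribing finitely many entries amounts to prepending
  \<open>f 0\<close> to a code of the shifted sequence.\<close>

lemma ex_seq_nth: "\<exists>s. \<forall>i<n. seq_nth s i = f i"
proof (induction n arbitrary: f)
  case (Suc n)
  from Suc[of "\<lambda>i. f (Suc i)"] obtain s where s: "\<forall>i<n. seq_nth s i = f (Suc i)" by blast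
  let ?s = "prod_encode (f 0, s)"
  have "rec_nat ?s (\<lambda>_ r. snd (prod_decode r)) (Suc i) = rec_nat s (\<lambda>_ r. snd (prod_decode r)) i" for i
    by (induction i) auto
  then have "seq_nth ?s (Suc i) = seq_nth s i" for i by (simp add: seq_nth_def)
  moreover have "seq_nth ?s 0 = f 0" by (simp add: seq_nth_def)
  ultimately have "\<forall>i<Suc n. seq_nth ?s i = f i" using s by (auto simp: less_Suc_eq_0_disj)
  then show ?case ..
qed simp

text \<open>Finitely many witnesses are collected in one coded sequence, and all checks are added
  up.\<close>

lemma semi_ball_less:
  fixes N :: "'a::encodable \<Rightarrow> nat"
  assumes "semi (\<lambda>p. P (fst p) (snd p))" and "computable N"
  shows "semi (\<lambda>x. \<forall>i<N x. P x i)"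
proof -
  from assms(1) obtain F where "enumerates F (\<lambda>p. P (fst p) (snd p))"
    unfolding semi_def by blast
  note F = enumeratesD[OF this]
  let ?F = "\<lambda>s x. rec_nat 0 (\<lambda>i r. r + F (seq_nth s i) (x, i)) (N x)"
  show ?thesis
  proof (rule semiI[where F = ?F])
    show "computable (\<lambda>p. ?F (fst p) (snd p))"
      by (intro computable_rec_nat computable_intros computable_compose2[OF F(1)] computable_seq_nth
        computable_compose[OF assms(2)])
    have *: "rec_nat 0 (\<lambda>i r. r + F (seq_nth s i) (x, i)) n = 0 \<longleftrightarrow> (\<forall>i<n. F (seq_nth s i) (x, i) = 0)"
      for s x n by (induction n) (auto simp: less_Suc_eq)
    show "(\<forall>i<N x. P x i) \<longleftrightarrow> (\<exists>s. ?F s x = 0)" for x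
    proof
      assume "\<forall>i<N x. P x i"
      then have "\<forall>i<N x. \<exists>z. F z (x, i) = 0" using F(2)[of "(x, _)"] by simp
      then obtain f where "\<forall>i<N x. F (f i) (x, i) = 0" by metis
      moreover obtain s where "\<forall>i<N x. seq_nth s i = f i" using ex_seq_nth[of "N x" f] by blast
      ultimately have "?F s x = 0" by (simp add: *)
      then show "\<exists>s. ?F s x = 0" ..
    next
      assume "\<exists>s. ?F s x = 0"
      then show "\<forall>i<N x. P x i" using F(2)[of "(x, _)"] by (auto simp: *)
    qed
  qed
qed

lemma semi_compose2:
  assumes "semi (\<lambda>p. R (fst p) (snd p))" and "computable f" and "computable g"
  shows "semi (\<lambda>x. R (f x) (g x))"
  using semi_compose[OF assms(1), of "\<lambda>x. (f x, g x)"] assms(2,3) by (simp add: computable_Pair)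

lemma semi_compose3:
  assumes "semi (\<lambda>p. R (fst p) (fst (snd p)) (snd (snd p)))"
    and "computable f" and "computable g" and "computable h"
  shows "semi (\<lambda>x. R (f x) (g x) (h x))"
  using semi_compose[OF assms(1), of "\<lambda>x. (f x, g x, h x)"] assms(2-4) by (simp add: computable_Pair)

section \<open>Inductive closures\<close>

text \<open>Rules have the conclusion first and exactly two premises; a rule with one premise leaves
  the other unconstrained, and its premise can be used twice.\<close>

inductive clos :: "('a \<Rightarrow> bool) \<Rightarrow> ('a \<Rightarrow> 'a \<Rightarrow> 'a \<Rightarrow> bool) \<Rightarrow> 'a \<Rightarrow> bool" for A R where
  base: "A c \<Longrightarrow> clos A R c"
| step: "R c a b \<Longrightarrow> clos A R a \<Longrightarrow> clos A R b \<Longrightarrow> clos A R c"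

definition derivation :: "('a \<Rightarrow> bool) \<Rightarrow> ('a \<Rightarrow> 'a \<Rightarrow> 'a \<Rightarrow> bool) \<Rightarrow> 'a list \<Rightarrow> bool" where
  "derivation A R cs \<longleftrightarrow> (\<forall>i<length cs. A (cs ! i) \<or>
     (\<exists>a\<in>set (take i cs). \<exists>b\<in>set (take i cs). R (cs ! i) a b))"

lemma derivation_append:
  assumes "derivation A R cs" and "derivation A R ds"
  shows "derivation A R (cs @ ds)"
  unfolding derivation_def
proof (intro allI impI)
  fix i assume i: "i < length (cs @ ds)"
  show "A ((cs @ ds) ! i) \<or>
      (\<exists>a\<in>set (take i (cs @ ds)). \<exists>b\<in>set (take i (cs @ ds)). R ((cs @ ds) ! i) a b)"
  proof (cases "i < length cs")
    case True
    with assms(1) show ?thesis by (simp add: derivation_def nth_append)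
  next
    case False
    with i have "i - length cs < length ds" by auto
    with assms(2) have "A (ds ! (i - length cs)) \<or> (\<exists>a\<in>set (take (i - length cs) ds).
        \<exists>b\<in>set (take (i - length cs) ds). R (ds ! (i - length cs)) a b)"
      unfolding derivation_def by blast
    with False show ?thesis by (auto simp: nth_append)
  qed
qed

lemma derivation_snoc:
  assumes "derivation A R cs" and "A c \<or> (\<exists>a\<in>set cs. \<exists>b\<in>set cs. R c a b)"
  shows "derivation A R (cs @ [c])"
  using assms by (auto simp: derivation_def nth_append less_Suc_eq)

lemma derivation_nth:
  assumes "derivation A R cs" and "i < length cs"
  shows "A (cs ! i) \<or> (\<exists>u<i. \<exists>v<i. R (cs ! i) (cs ! u) (cs ! v))"
  using assms by (fastforce simp: derivation_def simp flip: nth_image)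

text \<open>Derivation trees are flattened into lists in which each entry appeals only to earlier
  ones; two subderivations are simply concatenated.\<close>

lemma clos_iff_derivation: "clos A R c \<longleftrightarrow> (\<exists>cs. derivation A R cs \<and> c \<in> set cs)"
proof
  assume "clos A R c"
  then show "\<exists>cs. derivation A R cs \<and> c \<in> set cs"
  proof induction
    case (base c)
    then have "derivation A R ([] @ [c])" by (intro derivation_snoc) (auto simp: derivation_def)
    then show ?case by force
  next
    case (step c a b)
    then obtain cs ds where "derivation A R cs" "a \<in> set cs" "derivation A R ds" "b \<in> set ds"
      by blast
    then have "derivation A R ((cs @ ds) @ [c])"
      using step.hyps by (intro derivation_snoc derivation_append) auto
    then show ?case by force
  qed
next
  assume "\<exists>cs. derivation A R cs \<and> c \<in> set cs"
  then obtain cs where cs: "derivation A R cs" "c \<in> set cs" by blast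
  have "i < length cs \<Longrightarrow> clos A R (cs ! i)" for i
  proof (induction i rule: less_induct)
    case (less i)
    with cs(1) consider "A (cs ! i)" | u v where "u < i" "v < i" "R (cs ! i) (cs ! u) (cs ! v)"
      using derivation_nth by (metis less.prems)
    then show ?case using less by cases (auto intro: clos.intros)
  qed
  with cs(2) show "clos A R c" by (auto simp: in_set_conv_nth)
qed

text \<open>The search is for a coded derivation \<open>s\<close> and the position \<open>k\<close>
  of the conclusion. Checking it needs only a bounded quantifier over the positions up to
  \<open>k\<close>.\<close>

lemma semi_clos:
  fixes A :: "'a::re_type \<Rightarrow> bool"
  assumes "semi A" and "semi (\<lambda>p. R (fst p) (fst (snd p)) (snd (snd p)))"
  shows "semi (clos A R)"
proof -
  \<comment> \<open>Position \<open>i\<close> must hold the code of some object that is justified by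
    the base or by two earlier positions.\<close>
  let ?D = "\<lambda>s i. \<exists>c. enc c = seq_nth s i \<and> (A c \<or> (\<exists>u v. u < i \<and> v < i \<and>
      (\<exists>a b. enc a = seq_nth s u \<and> enc b = seq_nth s v \<and> R c a b)))"
  have "semi (\<lambda>x. \<exists>s k. enc x = seq_nth s k \<and> (\<forall>i<Suc k. ?D s i))"
    by (intro semi_intros computable_intros semi_ball_less computable_seq_nth
      semi_compose[OF assms(1)] semi_compose3[OF assms(2)])
  moreover have "clos A R x \<longleftrightarrow> (\<exists>s k. enc x = seq_nth s k \<and> (\<forall>i<Suc k. ?D s i))" for x
  proof
    assume "clos A R x"
    then obtain cs k where cs: "derivation A R cs" "k < length cs" "x = cs ! k"
      by (auto simp: clos_iff_derivation in_set_conv_nth)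
    obtain s where s: "\<forall>i<length cs. seq_nth s i = enc (cs ! i)"
      using ex_seq_nth[of "length cs" "\<lambda>i. enc (cs ! i)"] by blast
    have "?D s i" if "i < Suc k" for i
    proof (intro exI[of _ "cs ! i"] conjI)
      show "enc (cs ! i) = seq_nth s i" using s that cs(2) by simp
      have i: "i < length cs" using that cs(2) by simp
      then consider "A (cs ! i)" | u v where "u < i" "v < i" "R (cs ! i) (cs ! u) (cs ! v)"
        using derivation_nth[OF cs(1)] by metis
      then show "A (cs ! i) \<or> (\<exists>u v. u < i \<and> v < i \<and>
          (\<exists>a b. enc a = seq_nth s u \<and> enc b = seq_nth s v \<and> R (cs ! i) a b))"
      proof cases
        case 2
        with s i have "seq_nth s u = enc (cs ! u)" "seq_nth s v = enc (cs ! v)" by auto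
        with 2 show ?thesis by metis
      qed simp
    qed
    moreover have "enc x = seq_nth s k" using s cs by simp
    ultimately show "\<exists>s k. enc x = seq_nth s k \<and> (\<forall>i<Suc k. ?D s i)" by blast
  next
    assume "\<exists>s k. enc x = seq_nth s k \<and> (\<forall>i<Suc k. ?D s i)"
    then obtain s k where x: "enc x = seq_nth s k" and D: "\<And>i. i < Suc k \<Longrightarrow> ?D s i" by blast
    have "i < Suc k \<Longrightarrow> enc c = seq_nth s i \<Longrightarrow> clos A R c" for i c
    proof (induction i arbitrary: c rule: less_induct)
      case (less i)
      from D[OF less.prems(1)] obtain d where d: "enc d = seq_nth s i"
        and "A d \<or> (\<exists>u v. u < i \<and> v < i \<and>
          (\<exists>a b. enc a = seq_nth s u \<and> enc b = seq_nth s v \<and> R d a b))"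
        by blast
      moreover have "d = c" using d less.prems(2) by (simp add: enc_inject)
      ultimately consider "A c"
        | u v a b where "u < i" "v < i" "enc a = seq_nth s u" "enc b = seq_nth s v" "R c a b"
        by blast
      then show ?case
      proof cases
        case 1
        then show ?thesis by (rule clos.base)
      next
        case 2
        with less show ?thesis by (meson clos.step order_less_trans)
      qed
    qed
    with x show "clos A R x" by blast
  qed
  ultimately show ?thesis by (rule semi_cong)
qed

instance list :: (re_type) re_type
proof
  let ?A = "\<lambda>c. c = (0::nat)"
  \<comment> \<open>This is the code of a cons cell with tail \<open>a\<close>; the second premise
    \<open>b\<close> is a dummy.\<close>
  let ?R = "\<lambda>c a b :: nat. \<exists>h :: nat. c = Suc (prod_encode (h, a)) \<and> h \<in> range (enc :: 'a \<Rightarrow> nat)"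
  have "semi (clos ?A ?R)"
    by (intro semi_clos semi_intros computable_intros computable_prod_encode
      semi_compose[OF semi_range])
  moreover have "c \<in> range (enc :: 'a list \<Rightarrow> nat) \<longleftrightarrow> clos ?A ?R c" for c
  proof
    have "clos ?A ?R (enc xs)" for xs :: "'a list"
      by (induction xs) (auto intro: clos.intros)
    then show "c \<in> range (enc :: 'a list \<Rightarrow> nat) \<Longrightarrow> clos ?A ?R c" by auto
    assume "clos ?A ?R c"
    then show "c \<in> range (enc :: 'a list \<Rightarrow> nat)"
    proof induction
      case (base c)
      then show ?case by (metis enc_simps(3) rangeI)
    next
      case (step c a b)
      then obtain x and xs :: "'a list" where "c = enc (x # xs)" by auto
      then show ?case by blast
    qed
  qed
  ultimately show "semi (\<lambda>c. c \<in> range (enc :: 'a list \<Rightarrow> nat))" by simp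
qed

section \<open>Recursively enumerable relations as semidecidable predicates\<close>

inductive_simps rec_eval_iffs:
  "rec_eval Zero xs y" "rec_eval Succ xs y" "rec_eval (Proj i) xs y" "rec_eval (Comp f gs) xs y"
  "rec_eval (PrimRec f g) (k # xs) y" "rec_eval (Mu f) xs y"

text \<open>The program is fixed and only arguments and value vary, so structural induction on
  \<open>f\<close> applies.\<close>

lemma semi_rec_eval: "semi (\<lambda>p. rec_eval f (fst p) (snd p))"
proof (induction f)
  case Zero
  have "semi (\<lambda>p :: nat list \<times> nat. snd p = 0)"
    by (intro semi_intros computable_intros)
  then show ?case
    by (rule semi_cong) (auto simp: rec_eval_iffs)
next
  case Succ
  have "semi (\<lambda>p. \<exists>x. fst p = [x] \<and> snd p = Suc x)"
    by (intro semi_intros computable_intros)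
  then show ?case
    by (rule semi_cong) (auto simp: rec_eval_iffs)
next
  case (Proj i)
  have "semi (\<lambda>p :: nat list \<times> nat. i < length (fst p) \<and> snd p = fst p ! i)"
  proof (induction i)
    case 0
    have "semi (\<lambda>p. \<exists>x xs. fst p = x # xs \<and> snd p = (x :: nat))"
      by (intro semi_intros computable_intros)
    then show ?case by (rule semi_cong) (auto simp: length_Suc_conv neq_Nil_conv)
  next
    case (Suc i)
    have "semi (\<lambda>p. \<exists>x xs y. p = (x # xs, y :: nat) \<and> i < length xs \<and> y = xs ! i)"
      by (intro semi_intros computable_intros
        semi_compose2[where R = "\<lambda>xs y. i < length xs \<and> y = xs ! i", OF Suc.IH])
    then show ?case by (rule semi_cong) (auto simp: Suc_less_eq2 length_Suc_conv)
  qed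
  then show ?case
    by (rule semi_cong) (auto simp: rec_eval_iffs)
next
  case (Comp f gs)
  \<comment> \<open>The list \<open>gs\<close> is fixed too, so its finitely many evaluations are
    treated by an inner induction.\<close>
  have "semi (\<lambda>p. list_all2 (\<lambda>g. rec_eval g (fst p)) gs (snd p))"
    using Comp(2)
  proof (induction gs)
    case Nil
    have "semi (\<lambda>p :: nat list \<times> nat list. snd p = [])"
      by (intro semi_intros computable_intros)
    then show ?case by (rule semi_cong) auto
  next
    case (Cons g gs)
    have g: "semi (\<lambda>p. rec_eval g (fst p) (snd p))" using Cons.prems by simp
    have gs: "semi (\<lambda>p. list_all2 (\<lambda>g. rec_eval g (fst p)) gs (snd p))" using Cons by simp
    have "semi (\<lambda>p. \<exists>y ys. snd p = y # ys \<and> rec_eval g (fst p) y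
        \<and> list_all2 (\<lambda>g. rec_eval g (fst p)) gs ys)"
      by (intro semi_intros computable_intros semi_compose2[OF g]
        semi_compose2[where R = "\<lambda>xs. list_all2 (\<lambda>g. rec_eval g xs) gs", OF gs])
    then show ?case by (rule semi_cong) (auto simp: list_all2_Cons1)
  qed
  note gs = this
  have "semi (\<lambda>p. \<exists>ys. list_all2 (\<lambda>g. rec_eval g (fst p)) gs ys \<and> rec_eval f ys (snd p))"
    by (intro semi_intros computable_intros semi_compose2[OF Comp(1)]
      semi_compose2[where R = "\<lambda>xs. list_all2 (\<lambda>g. rec_eval g xs) gs", OF gs])
  then show ?case
    by (rule semi_cong) (auto simp: rec_eval_iffs)
next
  case (PrimRec f g)
  \<comment> \<open>The sequence \<open>s\<close> records all intermediate values of the recursion,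
    from \<open>0\<close> up to \<open>k\<close>.\<close>
  let ?Q = "\<lambda>xs y. \<exists>k ys s. xs = k # ys \<and> rec_eval f ys (seq_nth s 0)
    \<and> (\<forall>i<k. rec_eval g (i # seq_nth s i # ys) (seq_nth s (Suc i))) \<and> y = seq_nth s k"
  have "semi (\<lambda>p. ?Q (fst p) (snd p))"
    by (intro semi_intros computable_intros semi_ball_less computable_seq_nth
      semi_compose2[OF PrimRec(1)] semi_compose2[OF PrimRec(2)])
  moreover have "rec_eval (PrimRec f g) xs y \<longleftrightarrow> ?Q xs y" for xs y
  proof
    have "\<exists>h. rec_eval f ys (h 0) \<and> (\<forall>i<k. rec_eval g (i # h i # ys) (h (Suc i))) \<and> y = h k"
      if "rec_eval (PrimRec f g) (k # ys) y" for k ys y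
      using that
    proof (induction k arbitrary: y)
      case 0
      then have "rec_eval f ys y" by cases auto
      then show ?case by (intro exI[of _ "\<lambda>_. y"]) simp
    next
      case (Suc k)
      from Suc.prems obtain r where "rec_eval (PrimRec f g) (k # ys) r"
        and r: "rec_eval g (k # r # ys) y"
        by cases auto
      from Suc.IH[OF this(1)] obtain h where h: "rec_eval f ys (h 0)"
        "\<forall>i<k. rec_eval g (i # h i # ys) (h (Suc i))" "r = h k"
        by blast
      with r show ?case by (intro exI[of _ "h(Suc k := y)"]) (auto simp: less_Suc_eq)
    qed
    moreover assume y: "rec_eval (PrimRec f g) xs y"
    moreover obtain k ys where "xs = k # ys" using y by cases auto
    ultimately obtain h where h: "rec_eval f ys (h 0)"
      "\<forall>i<k. rec_eval g (i # h i # ys) (h (Suc i))" "y = h k"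
      by blast
    obtain s where "\<forall>i<Suc k. seq_nth s i = h i" using ex_seq_nth[of "Suc k" h] by blast
    with h \<open>xs = k # ys\<close> show "?Q xs y" by (intro exI[of _ k] exI[of _ ys] exI[of _ s]) auto
  next
    assume "?Q xs y"
    then obtain k ys s where Q: "xs = k # ys" "rec_eval f ys (seq_nth s 0)"
      "\<And>i. i < k \<Longrightarrow> rec_eval g (i # seq_nth s i # ys) (seq_nth s (Suc i))" "y = seq_nth s k"
      by blast
    have "i \<le> k \<Longrightarrow> rec_eval (PrimRec f g) (i # ys) (seq_nth s i)" for i
    proof (induction i)
      case 0
      show ?case by (rule rec_eval.PrimRec_0) (rule Q)
    next
      case (Suc i)
      then show ?case by (intro rec_eval.PrimRec_Suc[OF _ Q(3)]) auto
    qed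
    with Q show "rec_eval (PrimRec f g) xs y" by blast
  qed
  ultimately show ?case by (rule semi_cong)
next
  case (Mu f)
  have "semi (\<lambda>p. rec_eval f (snd p # fst p) 0 \<and>
      (\<forall>j<snd p. \<exists>y. rec_eval f (j # fst p) (Suc y)))"
    by (intro semi_intros computable_intros semi_ball_less semi_compose2[OF Mu])
  then show ?case
    by (rule semi_cong) (simp add: rec_eval_iffs)
qed

section \<open>Passage between RE relations and semidecidable predicates\<close>

lemma semi_length: "semi (\<lambda>xs :: 'a::re_type list. length xs = n)"
proof (induction n)
  case 0
  have "semi (\<lambda>xs :: 'a list. xs = [])"
    by (intro semi_intros computable_intros)
  then show ?case by (rule semi_cong) auto
next
  case (Suc n)
  have "semi (\<lambda>xs. \<exists>y :: 'a. \<exists>ys. xs = y # ys \<and> length ys = n)"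
    by (intro semi_intros computable_intros semi_compose[OF Suc.IH])
  then show ?case by (rule semi_cong) (auto simp: length_Suc_conv)
qed

lemma RE_imp_semi:
  assumes "RE n M"
  shows "semi (\<lambda>xs. xs \<in> M)"
proof -
  obtain f where f: "\<And>xs. length xs = n \<Longrightarrow> xs \<in> M \<longleftrightarrow> (\<exists>y. rec_eval f xs y)"
    using assms by (auto simp: RE_def)
  have "semi (\<lambda>xs. length xs = n \<and> (\<exists>y. rec_eval f xs y))"
    by (intro semi_intros computable_intros semi_compose2[OF semi_rec_eval] semi_compose[OF semi_length])
  then show ?thesis
    by (rule semi_cong) (use assms f in \<open>auto simp: RE_def nary_def\<close>)
qed

text \<open>The program minimises over witnesses; it halts exactly when one exists.\<close>

lemma semi_imp_RE:
  fixes P :: "nat list \<Rightarrow> bool"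
  assumes "semi P"
  shows "RE n {xs. length xs = n \<and> P xs}"
proof -
  obtain F where "enumerates F P" using assms unfolding semi_def by blast
  note F = enumeratesD[OF this]
  obtain G where G: "total_rec 1 (\<lambda>xs. G (xs ! 0))"
    "\<And>z xs. G (prod_encode (z, enc xs)) = F z xs"
    using F(1) by (auto simp: computable_def)
  have enc_list: "enc xs = list_encode xs" for xs :: "nat list"
    by (simp add: enc_list_def map_idI)
  \<comment> \<open>Subtracting 1 turns the code of the list \<open>z # xs\<close> into the code of
    the pair \<open>(z, xs)\<close>, on which \<open>G\<close> computes
    \<open>F z xs\<close>.\<close>
  have "total_rec (Suc n) (\<lambda>xs. G (list_encode xs - 1))"
    using total_rec_comp1[OF G(1), of "Suc n" "\<lambda>xs. list_encode xs - 1"]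
    by (simp add: total_rec_list_encode total_rec_diff total_rec_const)
  then obtain g where g: "\<And>xs. length xs = Suc n \<Longrightarrow> rec_eval g xs (G (list_encode xs - 1))"
    by (auto simp: total_rec_def)
  have "(\<exists>y. rec_eval (Mu g) xs y) \<longleftrightarrow> P xs" if "length xs = n" for xs
  proof -
    have g': "rec_eval g (z # xs) (F z xs)" for z
      using g[of "z # xs"] that G(2)[of z xs] by (simp add: enc_list)
    show ?thesis
    proof
      assume "\<exists>y. rec_eval (Mu g) xs y"
      then obtain k where "rec_eval g (k # xs) 0" by (auto simp: rec_eval_iffs)
      with g' have "F k xs = 0" using rec_eval_deterministic by blast
      then show "P xs" using F(2) by blast
    next
      assume "P xs"
      then have "F (LEAST z. F z xs = 0) xs = 0" unfolding F(2) by (rule LeastI_ex)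
      then have "rec_eval g ((LEAST z. F z xs = 0) # xs) 0" using g' by metis
      moreover have "\<exists>y. rec_eval g (j # xs) (Suc y)" if "j < (LEAST z. F z xs = 0)" for j
        using not_less_Least[OF that] g'[of j] by (metis not0_implies_Suc)
      ultimately have "rec_eval (Mu g) xs (LEAST z. F z xs = 0)" by (rule rec_eval.Mu)
      then show "\<exists>y. rec_eval (Mu g) xs y" ..
    qed
  qed
  then show ?thesis by (auto simp: RE_def nary_def)
qed

section \<open>Goedel numbers of terms and formulas\<close>

instantiation tm :: encodable
begin

definition "enc = gn_tm"

instance
proof
  fix s t :: tm
  have "gn_tm s = gn_tm t \<Longrightarrow> s = t"
  proof (induction s arbitrary: t)
    case (Var i)
    then show ?case by (cases t) auto
  next
    case (Fun f ts)
    from Fun.prems obtain us where us: "t = Fun f us" "map gn_tm ts = map gn_tm us"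
      by (cases t) (auto simp: list_encode_eq)
    from us(2) have "ts = us" by (rule list.inj_map_strong[rotated]) (rule Fun.IH)
    with us(1) show ?case by simp
  qed
  then show "enc s = enc t \<Longrightarrow> s = t" by (simp add: enc_tm_def)
qed

end

lemma enc_tm_simps [simp]:
  "enc (Var i) = prod_encode (0, i)"
  "enc (Fun f ts) = prod_encode (1, prod_encode (f, enc ts))"
  by (simp_all add: enc_tm_def enc_list_def)

text \<open>With Goedel numbers as codes, \<open>RE_theory\<close> becomes a statement about the
  codes of the axioms.\<close>

instantiation fm :: encodable
begin

definition "enc = gn"

instance
proof
  fix p q :: fm
  have inj: "inj gn_tm" by (rule injI) (metis enc_inject enc_tm_def)
  have "gn p = gn q \<Longrightarrow> p = q"
    by (induction p arbitrary: q; case_tac q)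
      (auto simp: list_encode_eq inj_eq[OF inj] inj_map_eq_map[OF inj])
  then show "enc p = enc q \<Longrightarrow> p = q" by (simp add: enc_fm_def)
qed

end

lemma enc_fm_simps [simp]:
  "enc Falsum = prod_encode (0, 0)"
  "enc (Eq s t) = prod_encode (1, prod_encode (enc s, enc t))"
  "enc (Rel r ts) = prod_encode (2, prod_encode (r, enc ts))"
  "enc (Imp p q) = prod_encode (3, prod_encode (enc p, enc q))"
  "enc (All p) = prod_encode (4, enc p)"
  by (simp_all add: enc_fm_def enc_tm_def enc_list_def)

lemma computable_syntax:
  "computable i \<Longrightarrow> computable (\<lambda>x. Var (i x))"
  "computable i \<Longrightarrow> computable ts \<Longrightarrow> computable (\<lambda>x. Fun (i x) (ts x))"
  "computable s \<Longrightarrow> computable t \<Longrightarrow> computable (\<lambda>x. Eq (s x) (t x))"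
  "computable i \<Longrightarrow> computable ts \<Longrightarrow> computable (\<lambda>x. Rel (i x) (ts x))"
  "computable p \<Longrightarrow> computable q \<Longrightarrow> computable (\<lambda>x. Imp (p x) (q x))"
  "computable p \<Longrightarrow> computable (\<lambda>x. All (p x))"
  by (rule computable_encD; simp add: computable_prod_encode computable_const computable_enc)+

lemmas semi_syntax_intros = semi_intros computable_intros computable_syntax computable_prod_encode

text \<open>Terms contain lists of terms. Generating lists, with a term represented by its singleton
  list, turns this nested recursion into a closure over one sort.\<close>

lemma semi_range_tms: "semi (\<lambda>c. c \<in> range (enc :: tm list \<Rightarrow> nat))"
proof -
  let ?A = "\<lambda>c. c = 0 \<or> (\<exists>i. c = Suc (prod_encode (prod_encode (0, i), 0)))"
  \<comment> \<open>The first rule prepends the entry of a singleton \<open>a\<close> to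
    \<open>b\<close>; the second turns the argument list \<open>a\<close> into a singleton function
    term.\<close>
  let ?R = "\<lambda>c a b. (\<exists>h. a = Suc (prod_encode (h, 0)) \<and> c = Suc (prod_encode (h, b))) \<or>
    (\<exists>f. c = Suc (prod_encode (prod_encode (1, prod_encode (f, a)), 0)))"
  have "semi (clos ?A ?R)"
    by (intro semi_clos semi_syntax_intros)
  moreover have "c \<in> range (enc :: tm list \<Rightarrow> nat) \<longleftrightarrow> clos ?A ?R c" for c
  proof
    have list: "clos ?A ?R (enc ts)" if "\<And>t. t \<in> set ts \<Longrightarrow> clos ?A ?R (enc [t])" for ts :: "tm list"
      using that
    proof (induction ts)
      case Nil
      show ?case by (rule clos.base) simp
    next
      case (Cons t ts)
      show ?case by (rule clos.step[of _ _ "enc [t]" "enc ts"]) (use Cons in auto)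
    qed
    have "clos ?A ?R (enc [t])" for t :: tm
    proof (induction t)
      case (Var i)
      show ?case by (rule clos.base) simp
    next
      case (Fun f ts)
      show ?case
        by (rule clos.step[of _ _ "enc ts" "enc ts"]) (use list[of ts] Fun in auto)
    qed
    with list show "c \<in> range (enc :: tm list \<Rightarrow> nat) \<Longrightarrow> clos ?A ?R c" by blast
    assume "clos ?A ?R c"
    then show "c \<in> range (enc :: tm list \<Rightarrow> nat)"
    proof induction
      case (base c)
      then consider "c = enc ([] :: tm list)" | i where "c = enc [Var i]" by auto
      then show ?case by cases (simp_all only: rangeI)
    next
      case (step c a b)
      then obtain ts us :: "tm list" where ab: "a = enc ts" "b = enc us" by blast
      from step(1) consider h where "a = Suc (prod_encode (h, 0))" "c = Suc (prod_encode (h, b))"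
        | f where "c = enc [Fun f ts]"
        using ab by auto
      then show ?case
      proof cases
        case 1
        with ab obtain t :: tm where "h = enc t" by (cases ts) auto
        with 1 ab have "c = enc (t # us)" by simp
        then show ?thesis by blast
      qed blast
    qed
  qed
  ultimately show ?thesis by (rule semi_cong)
qed

instance tm :: re_type
proof
  have "semi (\<lambda>c :: nat. Suc (prod_encode (c, 0)) \<in> range (enc :: tm list \<Rightarrow> nat))"
    by (intro semi_compose[OF semi_range_tms] semi_syntax_intros)
  moreover have "c \<in> range (enc :: tm \<Rightarrow> nat) \<longleftrightarrow>
      Suc (prod_encode (c, 0)) \<in> range (enc :: tm list \<Rightarrow> nat)" for c
  proof
    assume "c \<in> range (enc :: tm \<Rightarrow> nat)"
    then obtain t :: tm where "c = enc t" by blast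
    then have "Suc (prod_encode (c, 0)) = enc [t]" by simp
    then show "Suc (prod_encode (c, 0)) \<in> range (enc :: tm list \<Rightarrow> nat)" by (rule range_eqI)
  next
    assume "Suc (prod_encode (c, 0)) \<in> range (enc :: tm list \<Rightarrow> nat)"
    then obtain ts :: "tm list" where "Suc (prod_encode (c, 0)) = enc ts" by blast
    then show "c \<in> range (enc :: tm \<Rightarrow> nat)" by (cases ts) auto
  qed
  ultimately show "semi (\<lambda>c. c \<in> range (enc :: tm \<Rightarrow> nat))" by (rule semi_cong)
qed

instance fm :: re_type
proof
  let ?A = "\<lambda>c. c = prod_encode (0, 0) \<or> (\<exists>(s :: tm) (t :: tm). c = prod_encode (1, prod_encode (enc s, enc t))) \<or>
    (\<exists>r. \<exists>ts :: tm list. c = prod_encode (2, prod_encode (r, enc ts)))"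
  \<comment> \<open>These are the codes of implications and of universal formulas; terms enter only
    through the atomic base cases.\<close>
  let ?R = "\<lambda>c a b. c = prod_encode (3, prod_encode (a, b)) \<or> c = prod_encode (4, a)"
  have "semi (clos ?A ?R)"
    by (intro semi_clos semi_syntax_intros)
  moreover have "c \<in> range (enc :: fm \<Rightarrow> nat) \<longleftrightarrow> clos ?A ?R c" for c
  proof
    have "clos ?A ?R (enc p)" for p :: fm
    proof (induction p)
      case (Imp p q)
      show ?case by (rule clos.step[of _ _ "enc p" "enc q"]) (use Imp in simp_all)
    next
      case (All p)
      show ?case by (rule clos.step[of _ _ "enc p" "enc p"]) (use All in simp_all)
    qed (rule clos.base; auto)+
    then show "c \<in> range (enc :: fm \<Rightarrow> nat) \<Longrightarrow> clos ?A ?R c" by blast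
    assume "clos ?A ?R c"
    then show "c \<in> range (enc :: fm \<Rightarrow> nat)"
    proof induction
      case (base c)
      then consider "c = enc Falsum" | s t where "c = enc (Eq s t)" | r ts where "c = enc (Rel r ts)"
        by auto
      then show ?case by cases (simp_all only: rangeI)
    next
      case (step c a b)
      then obtain p q :: fm where "a = enc p" "b = enc q" by blast
      with step(1) have "c = enc (Imp p q) \<or> c = enc (All p)" by auto
      then show ?case by blast
    qed
  qed
  ultimately show "semi (\<lambda>c. c \<in> range (enc :: fm \<Rightarrow> nat))" by (rule semi_cong)
qed

section \<open>Substitution\<close>

text \<open>Every substitution that occurs in the calculus, also under binders, has this form:
  \<open>inst t\<close> starts from \<open>[t]\<close> with shift 0, and \<open>lift\<close> from \<open>[]\<close> with shift 1.\<close>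

fun list_subst :: "tm list \<Rightarrow> nat \<Rightarrow> nat \<Rightarrow> tm" where
  "list_subst [] j i = Var (i + j)"
| "list_subst (t # ts) j 0 = t"
| "list_subst (t # ts) j (Suc i) = list_subst ts j i"

lemma list_subst_inst: "list_subst [t] 0 = case_nat t Var"
proof
  show "list_subst [t] 0 i = case_nat t Var i" for i by (cases i) auto
qed

lemma list_subst_lift: "list_subst [] (Suc 0) = (\<lambda>i. Var (Suc i))"
  by auto

text \<open>Passing a binder again yields a substitution given by a finite list and a shift, so
  these finite data can be carried along in derivations.\<close>

lemma list_subst_under_binder:
  "case_nat (Var 0) (\<lambda>i. lift_tm (list_subst ts j i)) = list_subst (Var 0 # map lift_tm ts) (Suc j)"
proof
  have "lift_tm (list_subst ts j i) = list_subst (map lift_tm ts) (Suc j) i" for i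
    by (induction ts j i rule: list_subst.induct) auto
  then show "case_nat (Var 0) (\<lambda>i. lift_tm (list_subst ts j i)) i
      = list_subst (Var 0 # map lift_tm ts) (Suc j) i" for i
    by (cases i) auto
qed

text \<open>The graph of substitution is generated as a closure of triples: environment, argument
  list, result list.\<close>

lemma semi_subst_tms:
  "semi (\<lambda>p. snd (snd p) = map (subst_tm (list_subst (fst (fst p)) (snd (fst p)))) (fst (snd p)))"
    (is "semi ?P")
proof -
  let ?A = "\<lambda>c. (\<exists>e :: tm list \<times> nat. c = (e, [], [])) \<or>
    (\<exists>i j. c = (([], j), [Var i], [Var (i + j)])) \<or>
    (\<exists>t ts j. c = ((t # ts, j), [Var 0], [t]))"
  \<comment> \<open>The rules split a list into head and tail, descend into a function term, and
    look up a variable by dropping the first entry of the environment.\<close>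
  let ?R = "\<lambda>c a b.
    (\<exists>(e :: tm list \<times> nat) t ts u us. c = (e, t # ts, u # us) \<and> a = (e, [t], [u]) \<and> b = (e, ts, us)) \<or>
    (\<exists>(e :: tm list \<times> nat) f ts us. c = (e, [Fun f ts], [Fun f us]) \<and> a = (e, ts, us)) \<or>
    (\<exists>t ts j i u. c = ((t # ts, j), [Var (Suc i)], [u]) \<and> a = ((ts, j), [Var i], [u]))"
  have "semi (clos ?A ?R)"
    by (intro semi_clos semi_syntax_intros)
  moreover have "?P c \<longleftrightarrow> clos ?A ?R c" for c
  proof
    have list: "clos ?A ?R ((xs, j), ts, map f ts)"
      if "\<And>t. t \<in> set ts \<Longrightarrow> clos ?A ?R ((xs, j), [t], [f t])" for xs j ts f
      using that
    proof (induction ts)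
      case Nil
      show ?case by (rule clos.base) simp
    next
      case (Cons t ts)
      show ?case
        by (rule clos.step[of _ _ "((xs, j), [t], [f t])" "((xs, j), ts, map f ts)"])
          (use Cons in auto)
    qed
    have var: "clos ?A ?R ((xs, j), [Var i], [list_subst xs j i])" for xs j i
    proof (induction xs j i rule: list_subst.induct)
      case (3 t ts j i)
      show ?case
        by (rule clos.step[of _ _ "((ts, j), [Var i], [list_subst ts j i])"
            "((ts, j), [Var i], [list_subst ts j i])"]) (use 3 in auto)
    qed (rule clos.base; simp)+
    have tm: "clos ?A ?R ((xs, j), [t], [subst_tm (list_subst xs j) t])" for xs j t
    proof (induction t)
      case (Var i)
      show ?case using var by simp
    next
      case (Fun f ts)
      let ?c = "((xs, j), ts, map (subst_tm (list_subst xs j)) ts)"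
      show ?case
        by (rule clos.step[of _ _ ?c ?c]) (use list Fun in simp_all)
    qed
    assume "?P c"
    moreover obtain xs j ts us where c: "c = ((xs, j), ts, us)" by (metis surj_pair)
    ultimately have us: "us = map (subst_tm (list_subst xs j)) ts" by simp
    show "clos ?A ?R c" unfolding c us by (rule list[OF tm])
  next
    show "clos ?A ?R c \<Longrightarrow> ?P c"
    proof (induction rule: clos.induct)
      case (base c)
      then show ?case by auto
    next
      case (step c a b)
      then show ?case by auto
    qed
  qed
  ultimately show ?thesis by (rule semi_cong)
qed

lemma semi_map_lift:
  "computable f \<Longrightarrow> computable g \<Longrightarrow> semi (\<lambda>x. g x = map lift_tm (f x))"
  using semi_compose[OF semi_subst_tms, of "\<lambda>x. (([], 1), f x, g x)"]
  by (simp add: list_subst_lift computable_intros)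

lemma semi_subst:
  "semi (\<lambda>p. snd (snd p) = subst (list_subst (fst (fst p)) (snd (fst p))) (fst (snd p)))"
    (is "semi ?P")
proof -
  let ?tms = "\<lambda>e ts us. us = map (subst_tm (list_subst (fst e) (snd e))) ts"
  let ?A = "\<lambda>c. (\<exists>e :: tm list \<times> nat. c = (e, Falsum, Falsum)) \<or>
    (\<exists>(e :: tm list \<times> nat) s t s' t'. c = (e, Eq s t, Eq s' t') \<and> ?tms e [s, t] [s', t']) \<or>
    (\<exists>(e :: tm list \<times> nat) r ts us. c = (e, Rel r ts, Rel r us) \<and> ?tms e ts us)"
  \<comment> \<open>The environment changes at a quantifier. The lifted list \<open>us\<close> is a
    separate variable because lifting is available only through its semidecidable graph.\<close>
  let ?R = "\<lambda>c a b.
    (\<exists>(e :: tm list \<times> nat) p q p' q'. c = (e, Imp p q, Imp p' q') \<and> a = (e, p, p') \<and> b = (e, q, q')) \<or>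
    (\<exists>ts us j p p'. c = ((ts, j), All p, All p') \<and> us = map lift_tm ts \<and> a = ((Var 0 # us, Suc j), p, p'))"
  have "semi (clos ?A ?R)"
    by (intro semi_clos semi_intros(1-3) semi_ex semi_map_lift
      semi_compose3[where R = ?tms, OF semi_subst_tms] semi_syntax_intros)
  moreover have "?P c \<longleftrightarrow> clos ?A ?R c" for c
  proof
    have fm: "clos ?A ?R ((ts, j), p, subst (list_subst ts j) p)" for ts j p
    proof (induction p arbitrary: ts j)
      case (Imp p q)
      show ?case
        by (rule clos.step[of _ _ "((ts, j), p, subst (list_subst ts j) p)"
            "((ts, j), q, subst (list_subst ts j) q)"]) (use Imp in auto)
    next
      case (All p)
      let ?c = "((Var 0 # map lift_tm ts, Suc j), p, subst (list_subst (Var 0 # map lift_tm ts) (Suc j)) p)"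
      show ?case
        by (rule clos.step[of _ _ ?c ?c])
          (use All in \<open>auto simp: list_subst_under_binder simp del: list_subst.simps\<close>)
    qed (rule clos.base; simp)+
    assume "?P c"
    moreover obtain ts j p q where c: "c = ((ts, j), p, q)" by (metis surj_pair)
    ultimately have q: "q = subst (list_subst ts j) p" by simp
    show "clos ?A ?R c" unfolding c q by (rule fm)
  next
    show "clos ?A ?R c \<Longrightarrow> ?P c"
    proof (induction rule: clos.induct)
      case (base c)
      then show ?case by auto
    next
      case (step c a b)
      then show ?case by (auto simp: list_subst_under_binder simp del: list_subst.simps)
    qed
  qed
  ultimately show ?thesis by (rule semi_cong)
qed

lemma semi_inst:
  "computable t \<Longrightarrow> computable p \<Longrightarrow> computable q \<Longrightarrow> semi (\<lambda>x. q x = inst (t x) (p x))"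
  using semi_compose[OF semi_subst, of "\<lambda>x. (([t x], 0), p x, q x)"]
  by (simp add: list_subst_inst computable_intros)

lemma semi_lift:
  "computable p \<Longrightarrow> computable q \<Longrightarrow> semi (\<lambda>x. q x = lift (p x))"
  using semi_compose[OF semi_subst, of "\<lambda>x. (([], 1), p x, q x)"]
  by (simp add: list_subst_lift computable_intros)

section \<open>Provability\<close>

text \<open>Theorems of the Hilbert calculus are a closure: its base consists of the axioms of
  \<open>T\<close> and the logical axiom schemes.\<close>

lemma semi_provable:
  assumes "RE_theory T"
  shows "semi (\<lambda>p. T \<turnstile> p)"
proof -
  have T: "semi (\<lambda>p. p \<in> T)"
  proof (rule semi_cong)
    show "semi (\<lambda>p. [enc p] \<in> {[gn p] |p. p \<in> T})"
      using RE_imp_semi[OF assms[unfolded RE_theory_def]]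
      by (rule semi_compose) (intro computable_intros)
    show "p \<in> T \<longleftrightarrow> [enc p] \<in> {[gn p] |p. p \<in> T}" for p
      using enc_inject[of p] by (auto simp: enc_fm_def)
  qed
  \<comment> \<open>Results of \<open>inst\<close> and \<open>lift\<close> get variables of their
    own, since only the graphs of these operations are known to be semidecidable.\<close>
  let ?A = "\<lambda>c. c \<in> T \<or>
    (\<exists>p q. c = Imp p (Imp q p)) \<or>
    (\<exists>p q r. c = Imp (Imp p (Imp q r)) (Imp (Imp p q) (Imp p r))) \<or>
    (\<exists>p. c = Imp (Neg (Neg p)) p) \<or>
    (\<exists>t p q. c = Imp (All p) q \<and> q = inst t p) \<or>
    (\<exists>p q. c = Imp (All (Imp p q)) (Imp (All p) (All q))) \<or>
    (\<exists>p q. c = Imp p (All q) \<and> q = lift p) \<or>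
    (\<exists>t. c = Eq t t) \<or>
    (\<exists>s t p q r. c = Imp (Eq s t) (Imp q r) \<and> q = inst s p \<and> r = inst t p)"
  \<comment> \<open>Modus ponens uses both premises; generalisation constrains only the
    first.\<close>
  let ?R = "\<lambda>c a b. a = Imp b c \<or> c = All a"
  have "semi (clos ?A ?R)"
    by (intro semi_clos semi_intros(1-3) semi_ex semi_compose[OF T] semi_inst semi_lift semi_syntax_intros)
  moreover have "T \<turnstile> p \<longleftrightarrow> clos ?A ?R p" for p
  proof
    assume "T \<turnstile> p"
    then show "clos ?A ?R p"
    proof induction
      case (MP p q)
      show ?case by (rule clos.step[OF _ MP.IH]) simp
    next
      case (Gen p)
      show ?case by (rule clos.step[OF _ Gen.IH Gen.IH]) simp
    qed (rule clos.base; blast)+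
  next
    assume "clos ?A ?R p"
    then show "T \<turnstile> p"
    proof induction
      case (base c)
      then show ?case by (elim disjE exE conjE) (auto intro: provable.intros)
    next
      case (step c a b)
      then show ?case by (auto intro: provable.intros)
    qed
  qed
  ultimately show ?thesis by (rule semi_cong)
qed

section \<open>Propositional reasoning inside the calculus\<close>

lemma provable_Imp_trans: "T \<turnstile> Imp p q \<Longrightarrow> T \<turnstile> Imp q r \<Longrightarrow> T \<turnstile> Imp p r"
  by (meson MP K S)

lemma provable_IffD:
  assumes "T \<turnstile> Iff p q"
  shows "T \<turnstile> Imp p q" and "T \<turnstile> Imp q p"
proof -
  let ?a = "Imp p q" and ?b = "Imp q p"
  have explosion: "T \<turnstile> Imp Falsum r" for r
    by (rule provable_Imp_trans[OF K DN])
  \<comment> \<open>The biconditional abbreviates the negation of \<open>Imp ?a (Neg ?b)\<close>.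
    Each of \<open>Neg ?a\<close> and \<open>Neg ?b\<close> implies that formula, hence is
    refuted.\<close>
  have "T \<turnstile> Imp (Neg ?a) (Imp ?a (Neg ?b))"
    by (rule MP[OF S MP[OF K explosion]])
  then have "T \<turnstile> Neg (Neg ?a)"
    using assms by (rule provable_Imp_trans)
  then show "T \<turnstile> ?a" by (rule MP[OF DN])
  have "T \<turnstile> Neg (Neg ?b)"
    using K assms by (rule provable_Imp_trans)
  then show "T \<turnstile> ?b" by (rule MP[OF DN])
qed

lemma provable_Iff_cong:
  assumes "T \<turnstile> Iff p q"
  shows "T \<turnstile> p \<longleftrightarrow> T \<turnstile> q" and "T \<turnstile> Neg p \<longleftrightarrow> T \<turnstile> Neg q"
  using provable_IffD[OF assms] MP provable_Imp_trans by blast+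

section \<open>Formulas evaluated at numerals\<close>

lemma lift_numeral_tm: "lift_tm (numeral_tm k) = numeral_tm k"
  by (induction k) auto

text \<open>A numeral is never a variable, so the unnesting clause of \<open>trans_val\<close>
  applies, and it is closed, so lifting leaves it unchanged.\<close>

lemma trans_val_numeral_Suc:
  "trans_val I (numeral_tm (Suc k)) i = Ex (And (at_vars (dom_of I) [0])
     (And (trans_val I (numeral_tm k) 0) (at_vars (succ_of I) [0, Suc i])))"
  by (cases k) (simp_all add: lift_numeral_tm)

text \<open>All inner layers of the translation have target variable 0. The recursion is therefore
  done for index 0, and only the outermost layer takes index \<open>i\<close>.\<close>

lemma computable_trans_val_numeral:
  assumes "computable k"
  shows "computable (\<lambda>x. trans_val I (numeral_tm (k x)) i)"
proof -
  let ?S = "\<lambda>p i. Ex (And (at_vars (dom_of I) [0]) (And p (at_vars (succ_of I) [0, Suc i])))"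
  have 0: "trans_val I (numeral_tm k) 0 = rec_nat (at_vars (zero_of I) [0]) (\<lambda>_ p. ?S p 0) k" for k
    by (induction k) (simp_all only: trans_val_numeral_Suc, simp_all)
  have "trans_val I (numeral_tm k) i
      = rec_nat (at_vars (zero_of I) [i]) (\<lambda>k _. ?S (trans_val I (numeral_tm k) 0) i) k" for k
    by (cases k) (simp_all only: trans_val_numeral_Suc, simp_all)
  then show ?thesis
    using assms by (simp only: 0) (intro computable_rec_nat computable_intros computable_syntax)
qed

lemma computable_foldr_And:
  assumes "\<And>i. computable (\<lambda>x. f x i)" and "computable p"
  shows "computable (\<lambda>x. foldr And (map (f x) is) (p x))"
proof (induction "is")
  case (Cons i "is")
  then show ?case using assms(1)[of i] by (auto intro!: computable_syntax computable_const)
qed (simp add: assms)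

lemma computable_Ex_funpow:
  "computable p \<Longrightarrow> computable (\<lambda>x. (Ex ^^ n) (p x))"
  by (induction n) (auto intro!: computable_syntax computable_const)

lemma computable_at_numerals:
  assumes "computable p" and "computable y"
  shows "computable (\<lambda>x. at_numerals I (p x) (replicate n (y x)))"
proof -
  have "at_numerals I (p x) (replicate n (y x)) = (Ex ^^ n) (foldr And
     (map (\<lambda>i. And (at_vars (dom_of I) [i]) (trans_val I (numeral_tm (y x)) i)) [0..<n]) (p x))" for x
  proof -
    have "map (\<lambda>i. And (at_vars (dom_of I) [i]) (trans I (Eq (numeral_tm (replicate n (y x) ! i)) (Var i)))) [0..<n]
      = map (\<lambda>i. And (at_vars (dom_of I) [i]) (trans_val I (numeral_tm (y x)) i)) [0..<n]"
      by (rule map_cong) auto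
    then show ?thesis unfolding at_numerals_def length_replicate by (simp only:)
  qed
  then show ?thesis
    by (simp only:) (intro computable_Ex_funpow computable_foldr_And computable_syntax
      computable_trans_val_numeral computable_const assms)
qed

section \<open>The diagonal construction\<close>

lemma computable_pairing:
  assumes "recursive_pairing J" and "computable f" and "computable g"
  shows "computable (\<lambda>x. J (f x) (g x))"
proof (rule computable_compose2[of J, OF _ assms(2,3)])
  obtain r where r: "\<And>x y. rec_eval r [x, y] (J x y)"
    using assms(1) by (auto simp: recursive_pairing_def)
  have "total_rec 2 (\<lambda>xs. J (xs ! 0) (xs ! 1))"
    unfolding total_rec_def by (intro exI[of _ r]) (auto simp: r numeral_2_eq_2 length_Suc_conv)
  from total_rec_comp2[OF this total_rec_prod_decode(1)[OF total_rec_nth, of 0 1]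
      total_rec_prod_decode(2)[OF total_rec_nth, of 0 1]]
  have "total_rec 1 (\<lambda>xs. J (fst (prod_decode (xs ! 0))) (snd (prod_decode (xs ! 0))))" by simp
  then show "computable (\<lambda>p. J (fst p) (snd p))"
    unfolding computable_def
    by (intro exI[of _ "\<lambda>z. J (fst (prod_decode z)) (snd (prod_decode z))"]) auto
qed

text \<open>As tupling associates to the left, the head \<open>h\<close> absorbs the next entry
  \<open>x\<close> and the induction continues with head \<open>J h x\<close>.\<close>

lemma semi_tupling:
  assumes "recursive_pairing J"
  shows "semi (\<lambda>p. length (fst (snd p)) = n \<and> snd (snd p) = tupling J (fst p # fst (snd p)))"
proof (induction n)
  case 0
  have "semi (\<lambda>p :: nat \<times> nat list \<times> nat. fst (snd p) = [] \<and> snd (snd p) = fst p)"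
    by (intro semi_syntax_intros)
  then show ?case by (rule semi_cong) auto
next
  case (Suc n)
  have "semi (\<lambda>p. \<exists>x xs. fst (snd p) = x # xs \<and>
      (length xs = n \<and> snd (snd p) = tupling J (J (fst p) x # xs)))"
    by (intro semi_intros(1-3) semi_ex semi_compose3[OF Suc.IH] semi_syntax_intros
      computable_pairing[OF assms])
  then show ?case by (rule semi_cong) (auto simp: length_Suc_conv)
qed

text \<open>Injectivity of \<open>J\<close> undoes one absorbed entry at a time, which explains the
  restriction to equal lengths.\<close>

lemma tupling_inject:
  assumes "recursive_pairing J"
  shows "length xs = length ys \<Longrightarrow> tupling J (h # xs) = tupling J (k # ys) \<longleftrightarrow> h = k \<and> xs = ys"
proof -
  have J: "J a b = J c d \<longleftrightarrow> a = c \<and> b = d" for a b c d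
    using assms inj_eq[OF bij_is_inj, of "\<lambda>(x, y). J x y" "(a, b)" "(c, d)"]
    by (simp add: recursive_pairing_def)
  show "length xs = length ys \<Longrightarrow> tupling J (h # xs) = tupling J (k # ys) \<longleftrightarrow> h = k \<and> xs = ys"
    by (induction xs ys arbitrary: h k rule: list_induct2) (auto simp: J)
qed

section \<open>RE sets of constant tuples\<close>

definition diagonal_image ::
    "(nat \<Rightarrow> nat \<Rightarrow> nat) \<Rightarrow> nat \<Rightarrow> (nat \<Rightarrow> nat list \<Rightarrow> nat \<Rightarrow> bool) \<Rightarrow> nat list set" where
  "diagonal_image J n Q = {replicate n (tupling J (h # xs)) |h xs.
     length xs = n \<and> Q h xs (tupling J (h # xs))}"

text \<open>With \<open>n\<close> positive a constant tuple determines its entry, and the entry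
  determines \<open>h\<close> and \<open>xs\<close>; so membership cannot come from another
  representation.\<close>

lemma diagonal_image_iff:
  assumes "recursive_pairing J" and "n \<ge> 1" and "length xs = n"
  shows "replicate n (tupling J (h # xs)) \<in> diagonal_image J n Q \<longleftrightarrow> Q h xs (tupling J (h # xs))"
proof
  assume "replicate n (tupling J (h # xs)) \<in> diagonal_image J n Q"
  then obtain k ys where *: "length ys = n" "Q k ys (tupling J (k # ys))"
    "replicate n (tupling J (h # xs)) = replicate n (tupling J (k # ys))"
    by (auto simp: diagonal_image_def simp del: tupling.simps)
  then have "tupling J (h # xs) = tupling J (k # ys)"
    using assms(2) by (simp del: tupling.simps)
  then have "h = k \<and> xs = ys"
    using tupling_inject[OF assms(1)] * assms(3) by simp
  with * show "Q h xs (tupling J (h # xs))" by simp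
next
  assume "Q h xs (tupling J (h # xs))"
  with assms(3) show "replicate n (tupling J (h # xs)) \<in> diagonal_image J n Q"
    unfolding diagonal_image_def by blast
qed

lemma RE_diagonal_image:
  assumes "recursive_pairing J" and "semi (\<lambda>p. Q (fst p) (fst (snd p)) (snd (snd p)))"
  shows "RE n (diagonal_image J n Q)"
proof -
  have rep: "computable y \<Longrightarrow> computable (\<lambda>x. replicate n (y x))" for y :: "'a::encodable \<Rightarrow> nat"
    by (induction n) (auto intro: computable_intros)
  have "semi (\<lambda>zs. \<exists>h xs y. (length xs = n \<and> y = tupling J (h # xs)) \<and> zs = replicate n y \<and> Q h xs y)"
    by (intro semi_intros(1-3) semi_ex semi_compose3[OF semi_tupling[OF assms(1)]]
      semi_compose3[OF assms(2)] rep semi_syntax_intros)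
  from semi_imp_RE[OF this, of n] show ?thesis
    by (rule back_subst[of "RE n"]) (auto simp: diagonal_image_def)
qed

theorem theorem6p12:
  fixes J2 :: "nat \<Rightarrow> nat \<Rightarrow> nat" and L :: signature and T :: "fm set"
    and I :: translation and n :: nat
  assumes "recursive_pairing J2"
    and "is_theory L T" and "consistent T" and "RE_theory T"
    and "n \<ge> 1"
    and "rosser_via L T n I"
    and "\<And>h. admissible L T I n n (\<lambda>xs. replicate n (tupling J2 (h # xs)))"
  shows "exact_rosser L T n"
proof -
  have "\<exists>q. exactly_separates L T I n q M1 M2"
    if M: "RE n M1" "RE n M2" "M1 \<inter> M2 = {}" for M1 M2
  proof -
    let ?at = "\<lambda>p y. at_numerals I p (replicate n y)"
    \<comment> \<open>The index \<open>h\<close> ranges over all formulas, so that the separating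
      formula, chosen only afterwards, is among them.\<close>
    define A where "A = diagonal_image J2 n (\<lambda>h xs y. xs \<in> M1 \<or> (\<exists>p. h = enc p \<and> T \<turnstile> Neg (?at p y)))"
    define B where "B = diagonal_image J2 n (\<lambda>h xs y. xs \<in> M2 \<or> (\<exists>p. h = enc p \<and> T \<turnstile> ?at p y))"
    have "RE n A" "RE n B" unfolding A_def B_def
      by (intro RE_diagonal_image assms(1) semi_intros(1-3) semi_ex
        semi_compose[OF semi_provable[OF assms(4)]] semi_compose[OF RE_imp_semi[OF M(1)]]
        semi_compose[OF RE_imp_semi[OF M(2)]] computable_at_numerals semi_syntax_intros)+
    \<comment> \<open>The sets \<open>A\<close> and \<open>B\<close> may overlap; strong separation
      concerns only their differences.\<close>
    then obtain p where p: "strongly_separates L T I n p (A - B) (B - A)"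
      using assms(6) by (auto simp: rosser_via_def)
    \<comment> \<open>Self-reference: the index is the Goedel number of \<open>p\<close>
      itself.\<close>
    define F where "F = (\<lambda>xs. tupling J2 (enc p # xs))"
    obtain q where q: "fm_with_vars L n q"
      and "\<And>xs. length xs = n \<Longrightarrow> T \<turnstile> Iff (at_numerals I q xs) (?at p (F xs))"
      using assms(7)[of "enc p"] p by (auto simp: admissible_def strongly_separates_def F_def)
    note q_iff = provable_Iff_cong[OF this(2)]
    have A: "replicate n (F xs) \<in> A \<longleftrightarrow> xs \<in> M1 \<or> T \<turnstile> Neg (?at p (F xs))"
      and B: "replicate n (F xs) \<in> B \<longleftrightarrow> xs \<in> M2 \<or> T \<turnstile> ?at p (F xs)" if "length xs = n" for xs
      using diagonal_image_iff[OF assms(1,5) that] by (auto simp: A_def B_def F_def simp del: tupling.simps)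
    have sep: "replicate n (F xs) \<in> A - B \<Longrightarrow> T \<turnstile> ?at p (F xs)"
      "replicate n (F xs) \<in> B - A \<Longrightarrow> T \<turnstile> Neg (?at p (F xs))" for xs
      using p by (simp_all add: strongly_separates_def)
    have cons: "\<not> (T \<turnstile> r \<and> T \<turnstile> Neg r)" for r
      using assms(3) MP by (auto simp: consistent_def)
    \<comment> \<open>If \<open>xs\<close> is in \<open>M1\<close> but \<open>p\<close> is not
      provable at the tuple, the tuple lies in \<open>A - B\<close> by disjointness, so
      \<open>p\<close> is provable there after all. If \<open>p\<close> is provable but
      \<open>xs\<close> is not in \<open>M1\<close>, consistency puts the tuple in
      \<open>B - A\<close>, so \<open>p\<close> is also refutable. The case of \<open>M2\<close> is
      symmetric, and \<open>q_iff\<close> passes from \<open>p\<close> to \<open>q\<close>.\<close>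
    have "(xs \<in> M1 \<longleftrightarrow> T \<turnstile> at_numerals I q xs) \<and> (xs \<in> M2 \<longleftrightarrow> T \<turnstile> Neg (at_numerals I q xs))"
      if "length xs = n" for xs
      using A[OF that] B[OF that] sep[of xs] cons M(3) q_iff[OF that] by blast
    with q show ?thesis by (auto simp: exactly_separates_def)
  qed
  moreover have "interprets_Num L T I" using assms(6) by (simp add: rosser_via_def)
  ultimately show ?thesis unfolding exact_rosser_def by blast
qed

end
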